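(* Let $T=0$, $\epsilon>0$ admissible, and let $\mathbf X(t)=\mathbf X^{(\epsilon)}(t)$ be the Markov chain on $\mathbb N^{n_\epsilon}$ of the context. Let $(X^{(k)}(0))_{k\ge1}$ be deterministic initial conditions in $\mathbb N^{n_\epsilon}$ and $(z_k)_{k\ge1}$ positive integers with $z_k\to\infty$ such that $z_k^{-1}X^{(k)}(0)\to x(0)\in[0,\infty)^{n_\epsilon}$, and let $\mathbf X^{(k)}$ denote the chain started from $X^{(k)}(0)$. Then $\mathcal S(x(0))\neq\emptyset$ and for all $s>0$ and $\delta>0$, $$\lim_{k\to\infty}\mathbb P\Big(\inf_{f\in\mathcal S(x(0))}\ \sup_{t\in[0,s]}\big\|z_k^{-1}\mathbf X^{(k)}(z_kt)-f(t)\big\|_\infty>\delta\Big)=0.$$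
   Context: Setting ($T=0$). $\mathbf S=[-Q,Q]^2$ with opposite edges identified (flat torus), torus distance $\|\cdot\|$. Path-loss $l:[0,\infty)\to[0,\infty)$ bounded, non-increasing, $l(0)=1$; noise $\mathcal N_0>0$; constants $C>0$, $L>0$, $\lambda>0$. Discretization: $\epsilon>0$ is admissible if $2Q/\epsilon$ is an integer; tessellate $\mathbf S$ into $n_\epsilon=(2Q/\epsilon)^2$ squares $A_0,\dots,A_{n_\epsilon-1}$ of side $\epsilon$ with centers $a_i$ and $a_0=0$. Define $l_\epsilon(a_i,a_j)=\sup\{l(\|b-b'\|): b\in\overline{A_i},\,b'\in\overline{A_j}\}$. The chain $\mathbf X$ on $\mathbb N^{n_\epsilon}$ has transitions: for each $i$, $X_i\to X_i+1$ at rate $\lambda\epsilon^2$, and $X_i\to X_i-1$ at rate $\frac{C}{L}X_i\log_2\!\Big(1+\frac{1}{\mathcal N_0+\sum_{j}(X_j-\mathbf 1\{j=i\})\,l_\epsilon(a_i,a_j)}\Big)$. Fluid limits: for $y\in[0,\infty)^{n_\epsilon}$, $\mathcal S(y)$ is the set of functions $x:[0,\infty)\to[0,\infty)^{n_\epsilon}$ with $x(0)=y$ and $x_i(t)=x_i(0)+\lambda\epsilon^2t-D_i(t)$ for non-decreasing Lipschitz functions $D_i$ with $D_i(0)=0$, such that for almost every $t$: if $\|x(t)\|_\infty>0$ then $\dot D_i(t)=\frac{C\,x_i(t)}{L\ln(2)\sum_{k}x_k(t)\,l_\epsilon(a_i,a_k)}$ (interpreted as $0$ when $x_i(t)=0$),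 and if $\|x(t)\|_\infty=0$ then $\dot x_i(t)=0$ for all $i$. *)

theory Defs
  imports "HOL-Probability.Probability"
begin

definition tdist1 :: "real \<Rightarrow> real \<Rightarrow> real \<Rightarrow> real" where
  "tdist1 Q u v = Inf {\<bar>u - v + 2 * Q * of_int k\<bar> | k. True}"

definition tdist :: "real \<Rightarrow> real \<times> real \<Rightarrow> real \<times> real \<Rightarrow> real" where
  "tdist Q b b' = sqrt ((tdist1 Q (fst b) (fst b'))\<^sup>2 + (tdist1 Q (snd b) (snd b'))\<^sup>2)"

definition side :: "real \<Rightarrow> real \<Rightarrow> nat" where
  "side Q eps = nat \<lfloor>2 * Q / eps\<rfloor>"

definition admissible :: "real \<Rightarrow> real \<Rightarrow> bool" where
  "admissible Q eps \<longleftrightarrow> eps > 0 \<and> (\<exists>m::nat. 2 * Q / eps = real m)"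

definition ncells :: "real \<Rightarrow> real \<Rightarrow> nat" where
  "ncells Q eps = (side Q eps)\<^sup>2"

text \<open>Centre a_i of square A_i (i = p + m q, centre (p eps, q eps) taken modulo the torus);
  in particular a_0 = 0.\<close>
definition center :: "real \<Rightarrow> real \<Rightarrow> nat \<Rightarrow> real \<times> real" where
  "center Q eps i = (real (i mod side Q eps) * eps, real (i div side Q eps) * eps)"

text \<open>Closure of A_i (a representative closed square in R^2; the torus projection of it is the closure).\<close>
definition cell :: "real \<Rightarrow> real \<Rightarrow> nat \<Rightarrow> (real \<times> real) set" where
  "cell Q eps i = {b. \<bar>fst b - fst (center Q eps i)\<bar> \<le> eps / 2 \<and> \<bar>snd b - snd (center Q eps i)\<bar> \<le> eps / 2}"

definition leps :: "real \<Rightarrow> real \<Rightarrow> (real \<Rightarrow> real) \<Rightarrow> nat \<Rightarrow> nat \<Rightarrow> real" where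
  "leps Q eps l i j = Sup {l (tdist Q b b') | b b'. b \<in> cell Q eps i \<and> b' \<in> cell Q eps j}"

definition dep_rate ::
  "real \<Rightarrow> real \<Rightarrow> (real \<Rightarrow> real) \<Rightarrow> real \<Rightarrow> real \<Rightarrow> real \<Rightarrow> (nat \<Rightarrow> nat) \<Rightarrow> nat \<Rightarrow> real" where
  "dep_rate Q eps l N0 C L X i =
     C / L * real (X i) *
     log 2 (1 + 1 / (N0 + (\<Sum>j<ncells Q eps.
        (real (X j) - (if j = i then 1 else 0)) * leps Q eps l i j)))"

definition chain_rate ::
  "real \<Rightarrow> real \<Rightarrow> (real \<Rightarrow> real) \<Rightarrow> real \<Rightarrow> real \<Rightarrow> real \<Rightarrow> real \<Rightarrow> (nat \<Rightarrow> nat) \<Rightarrow> nat \<Rightarrow> real" where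
  "chain_rate Q eps l N0 C L lam X k =
     (if k < ncells Q eps then lam * eps\<^sup>2
      else dep_rate Q eps l N0 C L X (k - ncells Q eps))"

definition chain_move :: "real \<Rightarrow> real \<Rightarrow> (nat \<Rightarrow> nat) \<Rightarrow> nat \<Rightarrow> (nat \<Rightarrow> nat)" where
  "chain_move Q eps X k =
     (if k < ncells Q eps then X(k := X k + 1)
      else X(k - ncells Q eps := X (k - ncells Q eps) - 1))"

text \<open>K transition kinds, rate function r, move function mv. The kind of the next jump is
  chosen with a uniform variable u in [0,1) proportionally to the rates; the holding time is
  an Exp(1) variable divided by the total rate.\<close>
definition pick :: "nat \<Rightarrow> ((nat \<Rightarrow> nat) \<Rightarrow> nat \<Rightarrow> real) \<Rightarrow> (nat \<Rightarrow> nat) \<Rightarrow> real \<Rightarrow> nat" where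
  "pick K r x u = (LEAST k. u * (\<Sum>j<K. r x j) < (\<Sum>j<Suc k. r x j))"

fun jstate :: "nat \<Rightarrow> ((nat \<Rightarrow> nat) \<Rightarrow> nat \<Rightarrow> real) \<Rightarrow> ((nat \<Rightarrow> nat) \<Rightarrow> nat \<Rightarrow> (nat \<Rightarrow> nat))
   \<Rightarrow> (nat \<Rightarrow> nat) \<Rightarrow> (nat \<Rightarrow> real) \<Rightarrow> nat \<Rightarrow> (nat \<Rightarrow> nat)" where
  "jstate K r mv x0 u 0 = x0"
| "jstate K r mv x0 u (Suc m) = mv (jstate K r mv x0 u m) (pick K r (jstate K r mv x0 u m) (u m))"

fun jtime :: "nat \<Rightarrow> ((nat \<Rightarrow> nat) \<Rightarrow> nat \<Rightarrow> real) \<Rightarrow> ((nat \<Rightarrow> nat) \<Rightarrow> nat \<Rightarrow> (nat \<Rightarrow> nat))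
   \<Rightarrow> (nat \<Rightarrow> nat) \<Rightarrow> (nat \<Rightarrow> real) \<Rightarrow> (nat \<Rightarrow> real) \<Rightarrow> nat \<Rightarrow> real" where
  "jtime K r mv x0 u e 0 = 0"
| "jtime K r mv x0 u e (Suc m) =
     jtime K r mv x0 u e m + e m / (\<Sum>j<K. r (jstate K r mv x0 u m) j)"

text \<open>Value of the path at time t: the state after the jumps up to time t (after a possible
  explosion, which has probability zero, the value is set to 0).\<close>
definition ctmc_path :: "nat \<Rightarrow> ((nat \<Rightarrow> nat) \<Rightarrow> nat \<Rightarrow> real) \<Rightarrow> ((nat \<Rightarrow> nat) \<Rightarrow> nat \<Rightarrow> (nat \<Rightarrow> nat))
   \<Rightarrow> (nat \<Rightarrow> nat) \<Rightarrow> (nat \<Rightarrow> real) \<Rightarrow> (nat \<Rightarrow> real) \<Rightarrow> real \<Rightarrow> (nat \<Rightarrow> nat)" where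
  "ctmc_path K r mv x0 u e t =
     (if \<exists>m. t < jtime K r mv x0 u e (Suc m)
      then jstate K r mv x0 u (LEAST m. t < jtime K r mv x0 u e (Suc m))
      else (\<lambda>_. 0))"

definition chainX ::
  "real \<Rightarrow> real \<Rightarrow> (real \<Rightarrow> real) \<Rightarrow> real \<Rightarrow> real \<Rightarrow> real \<Rightarrow> real
   \<Rightarrow> (nat \<Rightarrow> nat) \<Rightarrow> (nat \<Rightarrow> real) \<Rightarrow> (nat \<Rightarrow> real) \<Rightarrow> real \<Rightarrow> (nat \<Rightarrow> nat)" where
  "chainX Q eps l N0 C L lam x0 u e =
     ctmc_path (2 * ncells Q eps) (chain_rate Q eps l N0 C L lam) (chain_move Q eps) x0 u e"

definition fluid_limits ::
  "real \<Rightarrow> real \<Rightarrow> (real \<Rightarrow> real) \<Rightarrow> real \<Rightarrow> real \<Rightarrow> real \<Rightarrow> (nat \<Rightarrow> real)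
   \<Rightarrow> (real \<Rightarrow> nat \<Rightarrow> real) set" where
  "fluid_limits Q eps l C L lam y =
    {x. (\<forall>i<ncells Q eps. x 0 i = y i) \<and>
        (\<forall>t\<ge>0. \<forall>i<ncells Q eps. x t i \<ge> 0) \<and>
        (\<exists>D :: nat \<Rightarrow> real \<Rightarrow> real.
           (\<forall>i<ncells Q eps.
              mono_on {0..} (D i) \<and> D i 0 = 0 \<and> (\<exists>K. K-lipschitz_on {0..} (D i)) \<and>
              (\<forall>t\<ge>0. x t i = x 0 i + lam * eps\<^sup>2 * t - D i t)) \<and>
           (AE t in lborel. t \<ge> 0 \<longrightarrow>
              ((\<exists>i<ncells Q eps. x t i > 0) \<longrightarrow>
                 (\<forall>i<ncells Q eps. (D i has_real_derivative
                    (if x t i = 0 then 0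
                     else C * x t i / (L * ln 2 * (\<Sum>k<ncells Q eps. x t k * leps Q eps l i k))))
                    (at t))) \<and>
              ((\<forall>i<ncells Q eps. x t i = 0) \<longrightarrow>
                 (\<forall>i<ncells Q eps. ((\<lambda>\<tau>. x \<tau> i) has_real_derivative 0) (at t)))))}"

end

(*
  The total jump rate is bounded, and after m jumps the number of transitions of each kind differs
  from its compensator by a sum of m orthogonal increments, of variance at most 6 m. Chebyshev's
  inequality at a bounded number of grid points, together with monotonicity of counts and
  compensators, shows that the scaled path is, with probability tending to 1, uniformly close to
  X(0)/z + a t - D(t), where D is Lipschitz and its increments lie between the extremes of the
  departure rate along the path. Lipschitz functions are locally uniformly compact, and every limit
  of such paths is a fluid limit, so both claims follow by contradiction.

  To identify the limit x at a time t > 0: neighbouring cells share boundary points, hence have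
  interference weight 1, and while a neighbour is positive the departure rate of a cell vanishes with
  its content. So at each time either all cells are positive, and the interval bounds yield the
  derivative of D, or all vanish, and x has derivative 0 at almost every such time by Lebesgue density.
*)
theory Submission
  imports Defs
begin

section \<open>Jump chains driven by independent noise\<close>

text \<open>The obstacle is the quotient of content and interference: it is bounded but
  discontinuous at the empty state, so the usual route through Lipschitz rates and Gronwall's
  inequality is closed, and the limit is a set of functions. Comparing increments of the departures
  with extreme values of the rate survives the passage to the limit without any regularity at that
  state.

  Counts are indexed by the number of jumps, not by time. Each jump is compensated by the
  probability of a kind times the Exp(1) variable of the holding time. The increments remain
  centred, and the accumulated compensator at a jump time is exactly the integral of the rate along
  the path, so no continuous-time martingale theory enters.

  Outside a small exceptional event all estimates concern one path at a time, with constants that do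
  not depend on the path. One statement then yields both claims: an exceptional event of probability
  below 1 leaves some path over, and this path provides a fluid limit.\<close>

locale jump_chain =
  fixes K :: nat and r :: "(nat \<Rightarrow> nat) \<Rightarrow> nat \<Rightarrow> real"
    and mv :: "(nat \<Rightarrow> nat) \<Rightarrow> nat \<Rightarrow> (nat \<Rightarrow> nat)" and R :: real and x0 :: "nat \<Rightarrow> nat"
  assumes rate_nonneg: "\<And>x k. k < K \<Longrightarrow> 0 \<le> r x k"
    and total_pos: "\<And>x. 0 < (\<Sum>k<K. r x k)"
    and total_le: "\<And>x. (\<Sum>k<K. r x k) \<le> R"
begin

abbreviation total :: "(nat \<Rightarrow> nat) \<Rightarrow> real" where "total x \<equiv> \<Sum>k<K. r x k"

abbreviation state :: "(nat \<Rightarrow> real) \<Rightarrow> nat \<Rightarrow> (nat \<Rightarrow> nat)" where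
  "state u m \<equiv> jstate K r mv x0 u m"

text \<open>The type of states is uncountable, but finitely many moves from \<open>x0\<close> lead
  to only countably many states. Measurability of a function of the random state can thus be checked
  state by state.\<close>

definition reachable :: "(nat \<Rightarrow> nat) set" where
  "reachable = range (foldl mv x0)"

definition increment :: "nat \<Rightarrow> (nat \<Rightarrow> nat) \<Rightarrow> real \<Rightarrow> real \<Rightarrow> real" where
  "increment j x v w = of_bool (pick K r x v = j) - r x j / total x * w"

definition count :: "nat \<Rightarrow> (nat \<Rightarrow> real) \<Rightarrow> nat \<Rightarrow> real" where
  "count j u m = (\<Sum>l<m. of_bool (pick K r (state u l) (u l) = j))"

definition compensator :: "nat \<Rightarrow> (nat \<Rightarrow> real) \<Rightarrow> (nat \<Rightarrow> real) \<Rightarrow> nat \<Rightarrow> real" where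
  "compensator j u e m = (\<Sum>l<m. r (state u l) j / total (state u l) * e l)"

definition mart :: "nat \<Rightarrow> (nat \<Rightarrow> real) \<Rightarrow> (nat \<Rightarrow> real) \<Rightarrow> nat \<Rightarrow> real" where
  "mart j u e m = (\<Sum>l<m. increment j (state u l) (u l) (e l))"

lemma mart_eq: "mart j u e m = count j u m - compensator j u e m"
  by (simp add: mart_def count_def compensator_def increment_def sum_subtractf)

lemma rate_le_total: "j < K \<Longrightarrow> r x j \<le> total x"
  using member_le_sum[of j "{..<K}" "r x"] rate_nonneg by auto

lemma countable_reachable: "countable reachable"
  by (simp add: reachable_def)

lemma x0_reachable: "x0 \<in> reachable"
  unfolding reachable_def by (rule range_eqI[of _ _ "[]"]) simp

lemma move_reachable: "x \<in> reachable \<Longrightarrow> mv x k \<in> reachable"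
  unfolding reachable_def by (auto intro: range_eqI[of _ _ "_ @ [k]"])

section \<open>Measurability of chain functionals in the noise\<close>

lemma pick_measurable [measurable]: "pick K r x \<in> borel \<rightarrow>\<^sub>M count_space UNIV"
proof -
  have "(\<lambda>u. LEAST k. u * total x < (\<Sum>j<Suc k. r x j)) \<in> borel \<rightarrow>\<^sub>M count_space UNIV"
    by (rule measurable_Least) measurable
  then show ?thesis
    by (simp add: pick_def[abs_def])
qed

lemma increment_measurable [measurable]:
  "(\<lambda>(v, w). increment j x v w) \<in> borel_measurable (borel \<Otimes>\<^sub>M borel)"
  unfolding increment_def by measurable

text \<open>The source space \<open>N\<close> is arbitrary because the lemma serves twice: on the
  probability space itself, and on a product space of noise values in the Fubini argument of
  \<open>increment_orthogonal\<close>.\<close>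

lemma state_measurable:
  fixes u :: "'b \<Rightarrow> nat \<Rightarrow> real"
  assumes "\<And>l. l < m \<Longrightarrow> (\<lambda>\<omega>. u \<omega> l) \<in> borel_measurable N"
  shows "(\<lambda>\<omega>. state (u \<omega>) m) \<in> N \<rightarrow>\<^sub>M count_space reachable"
  using assms
proof (induction m)
  case 0
  then show ?case by (simp add: x0_reachable)
next
  case (Suc m)
  have [measurable]: "(\<lambda>\<omega>. u \<omega> m) \<in> borel_measurable N"
    by (rule Suc.prems) simp
  have *: "(\<lambda>\<omega>. mv x (pick K r x (u \<omega> m))) \<in> N \<rightarrow>\<^sub>M count_space reachable" if x: "x \<in> reachable" for x
  proof -
    have "(\<lambda>k. mv x k) \<in> count_space UNIV \<rightarrow>\<^sub>M count_space reachable"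
      using move_reachable[OF x] by auto
    moreover have "(\<lambda>\<omega>. pick K r x (u \<omega> m)) \<in> N \<rightarrow>\<^sub>M count_space UNIV"
      by measurable
    ultimately show ?thesis
      by (rule measurable_compose[rotated])
  qed
  have "(\<lambda>\<omega>. state (u \<omega>) m) \<in> N \<rightarrow>\<^sub>M count_space reachable"
    by (rule Suc.IH) (simp add: Suc.prems)
  from measurable_compose_countable'[OF * this countable_reachable] show ?case
    by simp
qed

lemma mart_measurable:
  fixes u e :: "'b \<Rightarrow> nat \<Rightarrow> real"
  assumes u: "\<And>l. l < m \<Longrightarrow> (\<lambda>\<omega>. u \<omega> l) \<in> borel_measurable N"
    and e: "\<And>l. l < m \<Longrightarrow> (\<lambda>\<omega>. e \<omega> l) \<in> borel_measurable N"
  shows "(\<lambda>\<omega>. mart j (u \<omega>) (e \<omega>) m) \<in> borel_measurable N"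
  unfolding mart_def
proof (rule borel_measurable_sum)
  fix l assume "l \<in> {..<m}"
  then have l: "l < m" by simp
  note [measurable] = u[OF l] e[OF l]
  have *: "(\<lambda>\<omega>. increment j x (u \<omega> l) (e \<omega> l)) \<in> borel_measurable N" for x
    using measurable_compose[OF _ increment_measurable[of j x], of "\<lambda>\<omega>. (u \<omega> l, e \<omega> l)" N]
    by simp
  have "(\<lambda>\<omega>. state (u \<omega>) l) \<in> N \<rightarrow>\<^sub>M count_space reachable"
    using u l by (intro state_measurable) auto
  from measurable_compose_countable'[OF * this countable_reachable]
  show "(\<lambda>\<omega>. increment j (state (u \<omega>) l) (u \<omega> l) (e \<omega> l)) \<in> borel_measurable N" .
qed

lemma state_cong: "(\<And>l. l < m \<Longrightarrow> u l = u' l) \<Longrightarrow> state u m = state u' m"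
  by (induction m) simp_all

lemma mart_cong:
  assumes "\<And>l. l < m \<Longrightarrow> u l = u' l" "\<And>l. l < m \<Longrightarrow> e l = e' l"
  shows "mart j u e m = mart j u' e' m"
  unfolding mart_def
proof (rule sum.cong)
  fix l assume "l \<in> {..<m}"
  then show "increment j (state u l) (u l) (e l) = increment j (state u' l) (u' l) (e' l)"
    using assms state_cong[of l u u'] by simp
qed simp

lemma pick_eq_iff:
  assumes u: "0 \<le> u" "u < 1"
  shows "pick K r x u < K" and
    "pick K r x u = j \<longleftrightarrow> j < K \<and> (\<Sum>k<j. r x k) \<le> u * total x \<and> u * total x < (\<Sum>k<Suc j. r x k)"
proof -
  let ?P = "\<lambda>k. u * total x < (\<Sum>j<Suc k. r x j)"
  have K: "K > 0" using total_pos[of x] by (cases K) auto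
  \<comment> \<open>At \<open>K - 1\<close> the partial sum is the full total and
    \<open>u < 1\<close> makes the inequality strict, so the \<open>LEAST\<close> is attained below
    \<open>K\<close>.\<close>
  have *: "?P (K - 1)"
    using K total_pos[of x] u by simp
  have le: "pick K r x u \<le> K - 1"
    unfolding pick_def by (rule Least_le[of ?P, OF *])
  then show lt: "pick K r x u < K" using K by linarith
  have P: "?P (pick K r x u)"
    unfolding pick_def by (rule LeastI[of ?P, OF *])
  have nP: "\<not> ?P k" if "k < pick K r x u" for k
    using that unfolding pick_def by (rule not_less_Least)
  \<comment> \<open>Rates of index \<open>K\<close> or more may be negative, so partial sums are
    monotone only up to \<open>K\<close>.\<close>
  have mono: "(\<Sum>k<a. r x k) \<le> (\<Sum>k<b. r x k)" if "a \<le> b" "b \<le> K" for a b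
    using that by (intro sum_mono2) (auto intro: rate_nonneg)
  show "pick K r x u = j \<longleftrightarrow> j < K \<and> (\<Sum>k<j. r x k) \<le> u * total x \<and> u * total x < (\<Sum>k<Suc j. r x k)"
  proof
    assume j: "pick K r x u = j"
    have "(\<Sum>k<j. r x k) \<le> u * total x"
    proof (cases j)
      case 0
      then show ?thesis using u total_pos[of x] by simp
    next
      case (Suc i)
      then show ?thesis using nP[of i] j by simp
    qed
    then show "j < K \<and> (\<Sum>k<j. r x k) \<le> u * total x \<and> u * total x < (\<Sum>k<Suc j. r x k)"
      using j lt P by auto
  next
    assume j: "j < K \<and> (\<Sum>k<j. r x k) \<le> u * total x \<and> u * total x < (\<Sum>k<Suc j. r x k)"
    have "pick K r x u \<le> j"
      unfolding pick_def by (rule Least_le) (use j in blast)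
    moreover have "\<not> pick K r x u < j"
    proof
      assume "pick K r x u < j"
      then have "(\<Sum>k<Suc (pick K r x u). r x k) \<le> (\<Sum>k<j. r x k)"
        using j by (intro mono) auto
      then show False using P j by linarith
    qed
    ultimately show "pick K r x u = j" by simp
  qed
qed

text \<open>\<open>pick_eq_iff\<close> places \<open>u * total x\<close> in a half-open interval of
  length \<open>r x (pick K r x u)\<close>, which is therefore nonempty. Later this excludes
  departures from empty cells.\<close>

lemma rate_pick_pos:
  assumes "0 \<le> u" "u < 1"
  shows "0 < r x (pick K r x u)"
  using pick_eq_iff(2)[OF assms, of x "pick K r x u"] by simp

end

locale driven_jump_chain = jump_chain K r mv R x0 + prob_space M
  for K r mv R x0 and M :: "'a measure" +
  fixes E U :: "nat \<Rightarrow> 'a \<Rightarrow> real"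
  assumes indep: "indep_vars (\<lambda>_. borel) (\<lambda>v. case v of Inl m \<Rightarrow> E m | Inr m \<Rightarrow> U m) (UNIV :: (nat + nat) set)"
    and exp_distr: "\<And>m. distributed M lborel (E m) (\<lambda>x. ennreal (exponential_density 1 x))"
    and unif_distr: "\<And>m. distributed M lborel (U m) (\<lambda>x. ennreal (indicator {0..1} x))"
begin

section \<open>Moments of the noise and of a single increment\<close>

lemma E_measurable [measurable]: "E m \<in> borel_measurable M"
  using distributed_measurable[OF exp_distr[of m]] by simp

lemma U_measurable [measurable]: "U m \<in> borel_measurable M"
  using distributed_measurable[OF unif_distr[of m]] by simp

lemma noise_range: "AE \<omega> in M. \<forall>m. 0 \<le> E m \<omega> \<and> 0 \<le> U m \<omega> \<and> U m \<omega> < 1"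
proof -
  have "AE \<omega> in M. 0 \<le> E m \<omega>" for m
    by (subst distributed_AE2[OF exp_distr]) (auto simp: exponential_density_def erlang_density_def)
  moreover have "AE \<omega> in M. 0 \<le> U m \<omega> \<and> U m \<omega> < 1" for m
  proof (subst distributed_AE2[OF unif_distr])
    \<comment> \<open>The density admits the value 1, at which the search in \<open>pick\<close>
      would run past the last kind.\<close>
    have "AE x in lborel. x \<noteq> (1::real)"
      by (rule AE_lborel_singleton)
    then show "AE x in lborel. 0 < ennreal (indicator {0..1} x) \<longrightarrow> 0 \<le> x \<and> x < (1::real)"
      by eventually_elim (auto split: split_indicator_asm)
  qed auto
  ultimately show ?thesis
    by (simp add: AE_all_countable)
qed

text \<open>Almost surely the event says that the uniform variable lies in \<open>[a, b)\<close>,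
  whose length is the asserted probability.\<close>

lemma prob_pick:
  assumes j: "j < K"
  shows "expectation (\<lambda>\<omega>. of_bool (pick K r x (U m \<omega>) = j)) = r x j / total x"
proof -
  define a where "a = (\<Sum>k<j. r x k) / total x"
  define b where "b = (\<Sum>k<Suc j. r x k) / total x"
  note t = total_pos[of x]
  have "0 \<le> (\<Sum>k<j. r x k)"
    using j by (intro sum_nonneg rate_nonneg) auto
  moreover have "(\<Sum>k<Suc j. r x k) \<le> total x"
    using j by (intro sum_mono2) (auto intro: rate_nonneg)
  ultimately have ab: "0 \<le> a" "a \<le> b" "b \<le> 1" "b - a = r x j / total x"
    using rate_nonneg[OF j, of x] t by (simp_all add: a_def b_def divide_right_mono flip: diff_divide_distrib)
  have "expectation (\<lambda>\<omega>. of_bool (pick K r x (U m \<omega>) = j))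
    = (expectation (\<lambda>\<omega>. indicator {a..<b} (U m \<omega>)) :: real)"
  proof (rule integral_cong_AE)
    show "AE \<omega> in M. of_bool (pick K r x (U m \<omega>) = j) = (indicator {a..<b} (U m \<omega>) :: real)"
      using noise_range
    proof eventually_elim
      case (elim \<omega>)
      then have u: "0 \<le> U m \<omega>" "U m \<omega> < 1" by auto
      show ?case
        using pick_eq_iff(2)[OF u, of x j] j t
        by (auto simp: a_def b_def field_simps indicator_def)
    qed
  qed simp_all
  also have "\<dots> = (\<integral>v. indicator {0..1} v * indicator {a..<b} v \<partial>lborel)"
    by (rule distributed_integral[OF unif_distr, symmetric]) auto
  also have "\<dots> = (\<integral>v. indicator {a..<b} v \<partial>lborel)"
    using ab by (intro Bochner_Integration.integral_cong) (auto simp: indicator_def)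
  also have "\<dots> = b - a"
    using ab by simp
  finally show ?thesis using ab by simp
qed

lemma expectation_E: "expectation (E m) = 1" "expectation (\<lambda>\<omega>. (E m \<omega>)\<^sup>2) = 2"
  "integrable M (E m)" "integrable M (\<lambda>\<omega>. (E m \<omega>)\<^sup>2)"
  using erlang_ith_moment[OF _ exp_distr, of m 1] erlang_ith_moment[OF _ exp_distr, of m 2]
    erlang_ith_moment_integrable[OF _ exp_distr, of m 1] erlang_ith_moment_integrable[OF _ exp_distr, of m 2]
  by (simp_all add: eval_nat_numeral)

lemma expectation_increment:
  assumes j: "j < K"
  shows "expectation (\<lambda>\<omega>. increment j x (U m \<omega>) (E m \<omega>)) = 0"
proof -
  have "integrable M (\<lambda>\<omega>. of_bool (pick K r x (U m \<omega>) = j) :: real)"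
    by (rule integrable_const_bound[where B=1]) auto
  then show ?thesis
    unfolding increment_def using prob_pick[OF j, of x m] expectation_E
    by simp
qed

text \<open>Crude, but uniform in the state. Since an Exp(1) variable has second moment 2, this is
  the origin of the constant 6 = 2 + 2 * 2 in \<open>mart_variance\<close>.\<close>

lemma increment_square_le:
  assumes j: "j < K"
  shows "(increment j x v w)\<^sup>2 \<le> 2 + 2 * w\<^sup>2"
proof -
  define q where "q = r x j / total x"
  have q: "0 \<le> q" "q \<le> 1"
    using rate_nonneg[OF j, of x] rate_le_total[OF j, of x] total_pos[of x] by (auto simp: q_def)
  have "(p - q * w)\<^sup>2 \<le> 2 + 2 * w\<^sup>2" if "p = 0 \<or> p = 1" for p
  proof -
    have "(p - q * w)\<^sup>2 \<le> 2 * p\<^sup>2 + 2 * (q * w)\<^sup>2"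
      using zero_le_power2[of "p + q * w"] by (simp add: power2_eq_square algebra_simps)
    moreover have "(q * w)\<^sup>2 \<le> w\<^sup>2"
      using q by (simp add: power_mult_distrib mult_left_le_one_le power_le_one)
    moreover have "p\<^sup>2 \<le> 1" using that by auto
    ultimately show ?thesis by linarith
  qed
  from this[of "of_bool (pick K r x v = j)"] show ?thesis
    by (simp add: increment_def q_def)
qed

lemma process_measurable [measurable]:
  "(\<lambda>\<omega>. mart j (\<lambda>l. U l \<omega>) (\<lambda>l. E l \<omega>) m) \<in> borel_measurable M"
  "(\<lambda>\<omega>. state (\<lambda>l. U l \<omega>) m) \<in> M \<rightarrow>\<^sub>M count_space reachable"
  "(\<lambda>\<omega>. increment j (state (\<lambda>l. U l \<omega>) m) (U m \<omega>) (E m \<omega>)) \<in> borel_measurable M"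
proof -
  show m: "(\<lambda>\<omega>. mart j (\<lambda>l. U l \<omega>) (\<lambda>l. E l \<omega>) m) \<in> borel_measurable M" for m
    by (rule mart_measurable) auto
  show "(\<lambda>\<omega>. state (\<lambda>l. U l \<omega>) m) \<in> M \<rightarrow>\<^sub>M count_space reachable"
    by (rule state_measurable) auto
  have "(\<lambda>\<omega>. mart j (\<lambda>l. U l \<omega>) (\<lambda>l. E l \<omega>) (Suc m) - mart j (\<lambda>l. U l \<omega>) (\<lambda>l. E l \<omega>) m) \<in> borel_measurable M"
    using m[of "Suc m"] m[of m] by measurable
  then show "(\<lambda>\<omega>. increment j (state (\<lambda>l. U l \<omega>) m) (U m \<omega>) (E m \<omega>)) \<in> borel_measurable M"
    by (simp add: mart_def)
qed

section \<open>Orthogonality and variance of the compensated counts\<close>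

lemma mart_square_integrable:
  assumes j: "j < K"
  shows "integrable M (\<lambda>\<omega>. (mart j (\<lambda>l. U l \<omega>) (\<lambda>l. E l \<omega>) m)\<^sup>2)"
    and "integrable M (\<lambda>\<omega>. (increment j (state (\<lambda>l. U l \<omega>) m) (U m \<omega>) (E m \<omega>))\<^sup>2)"
proof -
  show i: "integrable M (\<lambda>\<omega>. (increment j (state (\<lambda>l. U l \<omega>) m) (U m \<omega>) (E m \<omega>))\<^sup>2)" for m
  proof (rule Bochner_Integration.integrable_bound)
    show "integrable M (\<lambda>\<omega>. 2 + 2 * (E m \<omega>)\<^sup>2)"
      using expectation_E by auto
  qed (use increment_square_le[OF j] in \<open>auto intro!: AE_I2\<close>)
  show "integrable M (\<lambda>\<omega>. (mart j (\<lambda>l. U l \<omega>) (\<lambda>l. E l \<omega>) m)\<^sup>2)"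
  proof (induction m)
    case 0
    then show ?case by (simp add: mart_def)
  next
    case (Suc m)
    let ?a = "\<lambda>\<omega>. mart j (\<lambda>l. U l \<omega>) (\<lambda>l. E l \<omega>) m"
    let ?b = "\<lambda>\<omega>. increment j (state (\<lambda>l. U l \<omega>) m) (U m \<omega>) (E m \<omega>)"
    show ?case
    proof (rule Bochner_Integration.integrable_bound)
      show "integrable M (\<lambda>\<omega>. 2 * (?a \<omega>)\<^sup>2 + 2 * (?b \<omega>)\<^sup>2)"
        using Suc i[of m] by auto
      have "(p + q)\<^sup>2 \<le> 2 * p\<^sup>2 + 2 * q\<^sup>2" for p q :: real
        using zero_le_power2[of "p - q"] by (simp add: power2_eq_square algebra_simps)
      then show "AE \<omega> in M. norm ((mart j (\<lambda>l. U l \<omega>) (\<lambda>l. E l \<omega>) (Suc m))\<^sup>2)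
          \<le> norm (2 * (?a \<omega>)\<^sup>2 + 2 * (?b \<omega>)\<^sup>2)"
        by (auto simp: mart_def)
    qed measurable
  qed
qed

text \<open>The state and \<open>mart\<close> after \<open>m\<close> jumps depend only on noise of
  index below \<open>m\<close>, the next increment on noise of index \<open>m\<close>. By
  independence the joint law is a product, and Fubini reduces the claim to a frozen past, where the
  state is a constant and \<open>expectation_increment\<close> applies.\<close>

lemma increment_orthogonal:
  fixes m :: nat
  assumes j: "j < K"
  defines "a \<equiv> \<lambda>\<omega>. mart j (\<lambda>l. U l \<omega>) (\<lambda>l. E l \<omega>) m"
    and "b \<equiv> \<lambda>\<omega>. increment j (state (\<lambda>l. U l \<omega>) m) (U m \<omega>) (E m \<omega>)"
  shows "integrable M (\<lambda>\<omega>. a \<omega> * b \<omega>)" and "expectation (\<lambda>\<omega>. a \<omega> * b \<omega>) = 0"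
proof -
  have [measurable]: "a \<in> borel_measurable M" "b \<in> borel_measurable M"
    unfolding a_def b_def by measurable
  show int: "integrable M (\<lambda>\<omega>. a \<omega> * b \<omega>)"
  proof (rule Bochner_Integration.integrable_bound)
    show "integrable M (\<lambda>\<omega>. (a \<omega>)\<^sup>2 + (b \<omega>)\<^sup>2)"
      using mart_square_integrable[OF j, of m] by (simp add: a_def b_def)
    have "\<bar>p * q\<bar> \<le> p\<^sup>2 + q\<^sup>2" for p q :: real
    proof -
      have "2 * (\<bar>p\<bar> * \<bar>q\<bar>) \<le> p\<^sup>2 + q\<^sup>2"
        using sum_squares_bound[of "\<bar>p\<bar>" "\<bar>q\<bar>"] by simp
      moreover have "0 \<le> \<bar>p\<bar> * \<bar>q\<bar>" by simp
      ultimately show ?thesis unfolding abs_mult by linarith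
    qed
    then show "AE \<omega> in M. norm (a \<omega> * b \<omega>) \<le> norm ((a \<omega>)\<^sup>2 + (b \<omega>)\<^sup>2)"
      by (auto intro!: AE_I2)
  qed measurable
  let ?X = "\<lambda>v. case v of Inl m \<Rightarrow> E m | Inr m \<Rightarrow> U m"
  \<comment> \<open>\<open>A\<close> indexes the past noise, \<open>B\<close> the pair of variables
    that drives jump \<open>m\<close>.\<close>
  define A where "A = (Inl ` {..<m} \<union> Inr ` {..<m} :: (nat + nat) set)"
  define B where "B = {Inl m, Inr m :: nat + nat}"
  let ?S = "PiM A (\<lambda>_. borel) :: (nat + nat \<Rightarrow> real) measure"
  let ?T = "PiM B (\<lambda>_. borel) :: (nat + nat \<Rightarrow> real) measure"
  let ?Y = "\<lambda>\<omega>. restrict (\<lambda>i. ?X i \<omega>) A" and ?V = "\<lambda>\<omega>. restrict (\<lambda>i. ?X i \<omega>) B"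
  define p where "p f = mart j (\<lambda>l. f (Inr l)) (\<lambda>l. f (Inl l)) m" for f :: "nat + nat \<Rightarrow> real"
  define x where "x f = state (\<lambda>l. f (Inr l)) m" for f :: "nat + nat \<Rightarrow> real"
  define v w where "v f = f (Inr m)" and "w f = f (Inl m)" for f :: "nat + nat \<Rightarrow> real"
  define F where "F = (\<lambda>(f, g). p f * increment j (x f) (v g) (w g))"
  have aY: "p (?Y \<omega>) = a \<omega>" for \<omega>
    unfolding p_def a_def by (rule mart_cong) (auto simp: A_def)
  have bY: "increment j (x (?Y \<omega>)) (v (?V \<omega>)) (w (?V \<omega>)) = b \<omega>" for \<omega>
  proof -
    have "x (?Y \<omega>) = state (\<lambda>l. U l \<omega>) m"
      unfolding x_def by (rule state_cong) (auto simp: A_def)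
    then show ?thesis by (simp add: b_def v_def w_def B_def)
  qed
  have ind: "indep_var ?S ?Y ?T ?V"
    by (rule indep_var_restrict[OF indep]) (auto simp: A_def B_def)
  then have Y: "?Y \<in> M \<rightarrow>\<^sub>M ?S" and V: "?V \<in> M \<rightarrow>\<^sub>M ?T"
    and eq: "distr M ?S ?Y \<Otimes>\<^sub>M distr M ?T ?V = distr M (?S \<Otimes>\<^sub>M ?T) (\<lambda>\<omega>. (?Y \<omega>, ?V \<omega>))"
    unfolding indep_var_distribution_eq by auto
  have c: "(\<lambda>f. f (Inr l)) \<in> borel_measurable ?S" "(\<lambda>f. f (Inl l)) \<in> borel_measurable ?S"
    if "l < m" for l
    using that by (auto intro!: measurable_component_singleton simp: A_def)
  have [measurable]: "v \<in> borel_measurable ?T" "w \<in> borel_measurable ?T"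
    unfolding v_def w_def by (auto intro!: measurable_component_singleton simp: B_def)
  have [measurable]: "p \<in> borel_measurable ?S"
    unfolding p_def by (intro mart_measurable c)
  have [measurable]: "x \<in> ?S \<rightarrow>\<^sub>M count_space reachable"
    unfolding x_def by (intro state_measurable c)
  have incr: "(\<lambda>g. increment j y (v g) (w g)) \<in> borel_measurable ?T" for y
    using measurable_compose[OF _ increment_measurable[of j y], of "\<lambda>g. (v g, w g)" ?T]
    by simp
  have F: "F \<in> borel_measurable (?S \<Otimes>\<^sub>M ?T)"
  proof -
    have *: "(\<lambda>q. p (fst q) * increment j y (v (snd q)) (w (snd q))) \<in> borel_measurable (?S \<Otimes>\<^sub>M ?T)" for y
      using measurable_compose[OF measurable_snd incr[of y], of ?S] by measurable
    have "(\<lambda>q. x (fst q)) \<in> (?S \<Otimes>\<^sub>M ?T) \<rightarrow>\<^sub>M count_space reachable"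
      by measurable
    from measurable_compose_countable'[OF * this countable_reachable] show ?thesis
      by (simp add: F_def case_prod_beta')
  qed
  interpret Y: prob_space "distr M ?S ?Y" by (rule prob_space_distr[OF Y])
  interpret V: prob_space "distr M ?T ?V" by (rule prob_space_distr[OF V])
  interpret P: pair_sigma_finite "distr M ?S ?Y" "distr M ?T ?V" ..
  have YV: "(\<lambda>\<omega>. (?Y \<omega>, ?V \<omega>)) \<in> M \<rightarrow>\<^sub>M ?S \<Otimes>\<^sub>M ?T"
    using Y V by (rule measurable_Pair)
  have FYV: "F (?Y \<omega>, ?V \<omega>) = a \<omega> * b \<omega>" for \<omega>
    by (simp only: F_def prod.case aY bY)
  have intF: "integrable (distr M ?S ?Y \<Otimes>\<^sub>M distr M ?T ?V) F"
    unfolding eq by (subst integrable_distr_eq[OF YV F]) (simp only: FYV int)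
  have "expectation (\<lambda>\<omega>. a \<omega> * b \<omega>) = (\<integral>q. F q \<partial>(distr M ?S ?Y \<Otimes>\<^sub>M distr M ?T ?V))"
    unfolding eq by (subst integral_distr[OF YV F]) (simp only: FYV)
  also have "\<dots> = (\<integral>f. (\<integral>g. F (f, g) \<partial>distr M ?T ?V) \<partial>distr M ?S ?Y)"
    by (rule P.integral_fst'[OF intF, symmetric])
  also have "\<dots> = (\<integral>f. 0 \<partial>distr M ?S ?Y)"
  proof (rule Bochner_Integration.integral_cong)
    fix f
    have "(\<lambda>g. F (f, g)) \<in> borel_measurable ?T"
      using incr[of "x f"] unfolding F_def by simp
    then have "(\<integral>g. F (f, g) \<partial>distr M ?T ?V) = expectation (\<lambda>\<omega>. F (f, ?V \<omega>))"
      by (rule integral_distr[OF V])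
    also have "\<dots> = expectation (\<lambda>\<omega>. p f * increment j (x f) (U m \<omega>) (E m \<omega>))"
      by (simp add: F_def v_def w_def B_def)
    also have "\<dots> = 0"
      using expectation_increment[OF j, of "x f" m] by simp
    finally show "(\<integral>g. F (f, g) \<partial>distr M ?T ?V) = 0" .
  qed simp
  finally show "expectation (\<lambda>\<omega>. a \<omega> * b \<omega>) = 0" by simp
qed

lemma mart_variance:
  assumes j: "j < K"
  shows "expectation (\<lambda>\<omega>. (mart j (\<lambda>l. U l \<omega>) (\<lambda>l. E l \<omega>) m)\<^sup>2) \<le> 6 * real m"
proof (induction m)
  case 0
  then show ?case by (simp add: mart_def)
next
  case (Suc m)
  let ?a = "\<lambda>\<omega>. mart j (\<lambda>l. U l \<omega>) (\<lambda>l. E l \<omega>) m"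
  let ?b = "\<lambda>\<omega>. increment j (state (\<lambda>l. U l \<omega>) m) (U m \<omega>) (E m \<omega>)"
  note i = mart_square_integrable[OF j, of m] and o = increment_orthogonal[OF j, of m]
  have "(\<lambda>\<omega>. (mart j (\<lambda>l. U l \<omega>) (\<lambda>l. E l \<omega>) (Suc m))\<^sup>2)
      = (\<lambda>\<omega>. (?a \<omega>)\<^sup>2 + 2 * (?a \<omega> * ?b \<omega>) + (?b \<omega>)\<^sup>2)"
    by (auto simp: mart_def power2_eq_square algebra_simps)
  then have "expectation (\<lambda>\<omega>. (mart j (\<lambda>l. U l \<omega>) (\<lambda>l. E l \<omega>) (Suc m))\<^sup>2)
      = expectation (\<lambda>\<omega>. (?a \<omega>)\<^sup>2) + expectation (\<lambda>\<omega>. (?b \<omega>)\<^sup>2)"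
    using i o by simp
  moreover have "expectation (\<lambda>\<omega>. (?b \<omega>)\<^sup>2) \<le> expectation (\<lambda>\<omega>. 2 + 2 * (E m \<omega>)\<^sup>2)"
    using i(2) expectation_E increment_square_le[OF j] by (intro integral_mono) auto
  moreover have "expectation (\<lambda>\<omega>. 2 + 2 * (E m \<omega>)\<^sup>2) = 6"
    using expectation_E by (simp add: prob_space)
  ultimately show ?case using Suc by simp
qed

lemma mart_deviation:
  assumes j: "j < K" and c: "c > 0"
  shows "prob {\<omega> \<in> space M. c \<le> \<bar>mart j (\<lambda>l. U l \<omega>) (\<lambda>l. E l \<omega>) m\<bar>} \<le> 6 * real m / c\<^sup>2"
proof -
  let ?a = "\<lambda>\<omega>. mart j (\<lambda>l. U l \<omega>) (\<lambda>l. E l \<omega>) m"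
  have "{\<omega> \<in> space M. c \<le> \<bar>?a \<omega>\<bar>} = {\<omega> \<in> space M. c\<^sup>2 \<le> (?a \<omega>)\<^sup>2}"
    using c by (auto simp: abs_le_square_iff[symmetric])
  moreover have "prob {\<omega> \<in> space M. c\<^sup>2 \<le> (?a \<omega>)\<^sup>2} \<le> expectation (\<lambda>\<omega>. (?a \<omega>)\<^sup>2) / c\<^sup>2"
    using mart_square_integrable[OF j] c
    by (intro integral_Markov_inequality_measure[where A="{}"]) auto
  ultimately show ?thesis
    using mart_variance[OF j, of m] c by (smt (verit) divide_right_mono zero_le_power2)
qed

text \<open>A union bound over \<open>K * (G + 1)\<close> pairs, each with the variance at the last
  grid index \<open>G * h\<close>. The null set where the noise leaves its range is put into
  \<open>A\<close> as well, so that outside \<open>A\<close> the pathwise results hold without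
  exception.\<close>

lemma bad_grid_event:
  fixes G h :: nat and c :: real
  assumes c: "c > 0"
  obtains A where "A \<in> sets M" "prob A \<le> real K * real (Suc G) * (6 * real (G * h) / c\<^sup>2)"
    "\<And>\<omega> m. \<omega> \<in> space M - A \<Longrightarrow> 0 \<le> E m \<omega> \<and> 0 \<le> U m \<omega> \<and> U m \<omega> < 1"
    "\<And>\<omega> j g. \<omega> \<in> space M - A \<Longrightarrow> j < K \<Longrightarrow> g \<le> G \<Longrightarrow> \<bar>mart j (\<lambda>l. U l \<omega>) (\<lambda>l. E l \<omega>) (g * h)\<bar> < c"
proof -
  define B where "B = {\<omega> \<in> space M. \<not> (\<forall>m. 0 \<le> E m \<omega> \<and> 0 \<le> U m \<omega> \<and> U m \<omega> < 1)}"
  define D where "D j g = {\<omega> \<in> space M. c \<le> \<bar>mart j (\<lambda>l. U l \<omega>) (\<lambda>l. E l \<omega>) (g * h)\<bar>}" for j g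
  define I where "I = {..<K} \<times> {..G}"
  have B: "B \<in> sets M" unfolding B_def by measurable
  have D: "D j g \<in> sets M" for j g unfolding D_def by measurable
  have "prob B = 0"
    using noise_range unfolding B_def by (subst prob_eq_0) (auto simp: B[unfolded B_def])
  moreover have "prob (\<Union>(j, g)\<in>I. D j g) \<le> (\<Sum>(j, g)\<in>I. prob (D j g))"
    using finite_measure_subadditive_finite[of I "\<lambda>(j, g). D j g"] D
    by (auto simp: I_def case_prod_beta' image_subset_iff)
  moreover have "(\<Sum>(j, g)\<in>I. prob (D j g)) \<le> (\<Sum>(j, g)\<in>I. 6 * real (G * h) / c\<^sup>2)"
  proof (rule sum_mono, clarify)
    fix j g assume "(j, g) \<in> I"
    then have jg: "j < K" "g \<le> G" by (auto simp: I_def)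
    have "prob (D j g) \<le> 6 * real (g * h) / c\<^sup>2"
      unfolding D_def by (rule mart_deviation[OF jg(1) c])
    also have "\<dots> \<le> 6 * real (G * h) / c\<^sup>2"
      using jg by (intro divide_right_mono mult_left_mono) (auto intro!: mult_right_mono)
    finally show "prob (D j g) \<le> 6 * real (G * h) / c\<^sup>2" .
  qed
  moreover have "(\<Sum>(j, g)\<in>I. 6 * real (G * h) / c\<^sup>2) = real K * real (Suc G) * (6 * real (G * h) / c\<^sup>2)"
    by (simp add: I_def case_prod_beta' del: of_nat_Suc mult_Suc_right)
  moreover have "prob (B \<union> (\<Union>(j, g)\<in>I. D j g)) \<le> prob B + prob (\<Union>(j, g)\<in>I. D j g)"
    using B D by (intro measure_Un_le) (auto simp: I_def)
  ultimately have bound: "prob (B \<union> (\<Union>(j, g)\<in>I. D j g)) \<le> real K * real (Suc G) * (6 * real (G * h) / c\<^sup>2)"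
    by linarith
  have sets: "B \<union> (\<Union>(j, g)\<in>I. D j g) \<in> sets M"
    using B D by (intro sets.Un sets.finite_UN) (auto simp: I_def)
  show ?thesis
  proof (rule that[OF sets bound])
    fix \<omega> assume "\<omega> \<in> space M - (B \<union> (\<Union>(j, g)\<in>I. D j g))"
    then have \<omega>: "\<omega> \<in> space M" "\<omega> \<notin> B" "\<And>j g. (j, g) \<in> I \<Longrightarrow> \<omega> \<notin> D j g" by auto
    show "0 \<le> E m \<omega> \<and> 0 \<le> U m \<omega> \<and> U m \<omega> < 1" for m
      using \<omega>(1,2) unfolding B_def by blast
    show "\<bar>mart j (\<lambda>l. U l \<omega>) (\<lambda>l. E l \<omega>) (g * h)\<bar> < c" if "j < K" "g \<le> G" for j g
      using \<omega>(1) \<omega>(3)[of j g] that unfolding D_def I_def by simp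
  qed
qed

end

section \<open>Paths and integrated rates\<close>

locale jump_path = jump_chain K r mv R x0
  for K r mv R x0 +
  fixes u e :: "nat \<Rightarrow> real"
  assumes noise: "\<And>m. 0 \<le> u m" "\<And>m. u m < 1" "\<And>m. 0 \<le> e m"
begin

abbreviation time :: "nat \<Rightarrow> real" where "time m \<equiv> jtime K r mv x0 u e m"
abbreviation path :: "real \<Rightarrow> (nat \<Rightarrow> nat)" where "path t \<equiv> ctmc_path K r mv x0 u e t"

text \<open>For \<open>t\<close> up to the time of the \<open>n\<close>-th jump this is the integral over \<open>[0, t]\<close> of the rate of the
  \<open>j\<close>-th transition kind along the path.\<close>
definition integrated_rate :: "nat \<Rightarrow> nat \<Rightarrow> real \<Rightarrow> real" where
  "integrated_rate n j t = (\<Sum>l<n. r (state u l) j * (min t (time (Suc l)) - min t (time l)))"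

lemma time_Suc_ge: "time m \<le> time (Suc m)"
  using noise(3)[of m] total_pos[of "state u m"] by simp

lemma time_mono: "m \<le> m' \<Longrightarrow> time m \<le> time m'"
  by (rule lift_Suc_mono_le[of time]) (use time_Suc_ge in auto)

lemma path_eq_state:
  assumes "time m \<le> t" "t < time (Suc m)"
  shows "path t = state u m"
proof -
  have "(LEAST m. t < time (Suc m)) = m"
  proof (rule Least_equality)
    fix k assume "t < time (Suc k)"
    then show "m \<le> k"
      using assms time_mono[of "Suc k" m] by (cases "m \<le> k") auto
  qed (rule assms)
  then show ?thesis
    unfolding ctmc_path_def using assms(2) by auto
qed

lemma obtain_jump:
  assumes "0 \<le> t" "t < time n"
  obtains m where "m < n" "time m \<le> t" "t < time (Suc m)"
proof -
  define k where "k = (LEAST k. t < time k)"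
  have k: "t < time k" "k \<le> n"
    unfolding k_def by (rule LeastI[of _ n] Least_le, rule assms)+
  have "k \<noteq> 0" using k(1) assms(1) by (cases k) auto
  then obtain m where m: "k = Suc m" by (cases k) auto
  have "\<not> t < time m"
    using not_less_Least[of m "\<lambda>k. t < time k"] m unfolding k_def[symmetric] by simp
  then show ?thesis using that[of m] k m by auto
qed

text \<open>The expression is the length of the part of \<open>[s, t]\<close> that lies between the
  jump times \<open>time l\<close> and \<open>time (Suc l)\<close>.\<close>

lemma sojourn_nonneg:
  assumes "s \<le> t"
  shows "0 \<le> (min t (time (Suc l)) - min t (time l)) - (min s (time (Suc l)) - min s (time l))"
  using time_Suc_ge[of l] assms by (auto simp: min_def)

lemma sum_sojourn: "0 \<le> t \<Longrightarrow> (\<Sum>l<n. min t (time (Suc l)) - min t (time l)) = min t (time n)"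
  by (subst sum_lessThan_telescope[of "\<lambda>l. min t (time l)"]) simp

lemma integrated_rate_0: "integrated_rate n j 0 = 0"
proof -
  have "min 0 (time l) = 0" for l
    using time_mono[of 0 l] by simp
  then show ?thesis by (simp add: integrated_rate_def del: jtime.simps)
qed

lemma integrated_rate_diff:
  "integrated_rate n j t - integrated_rate n j s = (\<Sum>l<n. r (state u l) j *
     ((min t (time (Suc l)) - min t (time l)) - (min s (time (Suc l)) - min s (time l))))"
  by (simp add: integrated_rate_def sum_subtractf[symmetric] right_diff_distrib)

lemma integrated_rate_mono:
  assumes "j < K" "s \<le> t"
  shows "integrated_rate n j s \<le> integrated_rate n j t"
proof -
  have "0 \<le> integrated_rate n j t - integrated_rate n j s"
    unfolding integrated_rate_diff using assms
    by (intro sum_nonneg mult_nonneg_nonneg sojourn_nonneg rate_nonneg)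
  then show ?thesis by simp
qed

lemma integrated_rate_lipschitz:
  assumes j: "j < K"
  shows "R-lipschitz_on {0..} (integrated_rate n j)"
proof -
  have R: "0 \<le> R" using total_pos[of x0] total_le[of x0] by linarith
  have *: "integrated_rate n j t - integrated_rate n j s \<le> R * (t - s)" if "0 \<le> s" "s \<le> t" for s t
  proof -
    have "integrated_rate n j t - integrated_rate n j s \<le> (\<Sum>l<n. R *
     ((min t (time (Suc l)) - min t (time l)) - (min s (time (Suc l)) - min s (time l))))"
      unfolding integrated_rate_diff using that
      by (intro sum_mono mult_right_mono sojourn_nonneg order.trans[OF rate_le_total[OF j] total_le])
    also have "\<dots> = R * (min t (time n) - min s (time n))"
      using that sum_sojourn[of s n] sum_sojourn[of t n]
      by (simp add: sum_subtractf del: jtime.simps flip: sum_distrib_left)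
    also have "\<dots> \<le> R * (t - s)"
      using that R by (intro mult_left_mono) (auto simp: min_def)
    finally show ?thesis .
  qed
  show ?thesis
  proof (rule lipschitz_onI)
    fix s t :: real assume "s \<in> {0..}" "t \<in> {0..}"
    then show "dist (integrated_rate n j s) (integrated_rate n j t) \<le> R * dist s t"
      using *[of s t] *[of t s] integrated_rate_mono[OF j, of s t n] integrated_rate_mono[OF j, of t s n]
      by (cases "s \<le> t") (auto simp: dist_real_def)
  qed (rule R)
qed

lemma integrated_rate_between:
  assumes st: "0 \<le> s" "s \<le> t" "t \<le> time n"
    and bd: "\<And>v. s \<le> v \<Longrightarrow> v \<le> t \<Longrightarrow> \<alpha> \<le> r (path v) j \<and> r (path v) j \<le> \<beta>"
  shows "\<alpha> * (t - s) \<le> integrated_rate n j t - integrated_rate n j s"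
    and "integrated_rate n j t - integrated_rate n j s \<le> \<beta> * (t - s)"
proof -
  let ?\<Delta> = "\<lambda>l. (min t (time (Suc l)) - min t (time l)) - (min s (time (Suc l)) - min s (time l))"
  have \<Delta>: "\<alpha> * ?\<Delta> l \<le> r (state u l) j * ?\<Delta> l" "r (state u l) j * ?\<Delta> l \<le> \<beta> * ?\<Delta> l" for l
  proof -
    have "\<alpha> * ?\<Delta> l \<le> r (state u l) j * ?\<Delta> l \<and> r (state u l) j * ?\<Delta> l \<le> \<beta> * ?\<Delta> l"
    proof (cases "?\<Delta> l = 0")
      case False
      \<comment> \<open>If \<open>[s, t]\<close> meets the sojourn in positive length,
        \<open>v\<close> is the first common point, and there the path equals
        \<open>state u l\<close>.\<close>
      define v where "v = max s (time l)"
      have v: "time l \<le> v" "v < time (Suc l)" "s \<le> v" "v \<le> t"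
        using False time_Suc_ge[of l] st by (auto simp: v_def min_def max_def simp del: jtime.simps split: if_splits)
      then have "\<alpha> \<le> r (state u l) j \<and> r (state u l) j \<le> \<beta>"
        using bd[of v] path_eq_state[of l v] by simp
      then show ?thesis
        using sojourn_nonneg[OF st(2), of l] by (meson mult_right_mono)
    qed simp
    then show "\<alpha> * ?\<Delta> l \<le> r (state u l) j * ?\<Delta> l" "r (state u l) j * ?\<Delta> l \<le> \<beta> * ?\<Delta> l" by auto
  qed
  have sum: "(\<Sum>l<n. \<gamma> * ?\<Delta> l) = \<gamma> * (t - s)" for \<gamma>
  proof -
    have "0 \<le> t" using st by linarith
    then show ?thesis
      using st sum_sojourn[of s n] sum_sojourn[of t n]
      by (simp add: sum_subtractf del: jtime.simps flip: sum_distrib_left)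
  qed
  show "\<alpha> * (t - s) \<le> integrated_rate n j t - integrated_rate n j s"
    unfolding integrated_rate_diff sum[symmetric] by (rule sum_mono, rule \<Delta>)
  show "integrated_rate n j t - integrated_rate n j s \<le> \<beta> * (t - s)"
    unfolding integrated_rate_diff sum[symmetric] by (rule sum_mono, rule \<Delta>)
qed

lemma integrated_rate_at_jump:
  assumes "m \<le> n"
  shows "integrated_rate n j (time m) = compensator j u e m"
proof -
  have "integrated_rate n j (time m) = (\<Sum>l<n. if l < m then r (state u l) j / total (state u l) * e l else 0)"
    unfolding integrated_rate_def
  proof (rule sum.cong)
    fix l
    have "min (time m) (time (Suc l)) = time (Suc l)" "min (time m) (time l) = time l" if "l < m"
      using time_mono[of "Suc l" m] time_mono[of l m] that by (auto simp: min_def)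
    moreover have "min (time m) (time (Suc l)) = time m" "min (time m) (time l) = time m" if "\<not> l < m"
      using time_mono[of m "Suc l"] time_mono[of m l] that by (auto simp: min_def)
    ultimately show "r (state u l) j * (min (time m) (time (Suc l)) - min (time m) (time l))
      = (if l < m then r (state u l) j / total (state u l) * e l else 0)"
      by (cases "l < m") simp_all
  qed simp
  also have "\<dots> = compensator j u e m"
    unfolding compensator_def using assms
    by (intro sum.mono_neutral_cong_right) auto
  finally show ?thesis .
qed

lemma compensator_mono:
  assumes "j < K" "m \<le> m'"
  shows "compensator j u e m \<le> compensator j u e m'"
  using integrated_rate_mono[OF assms(1) time_mono[OF assms(2)], of m'] assms
  by (simp add: integrated_rate_at_jump)

lemma count_mono: "m \<le> m' \<Longrightarrow> count j u m \<le> count j u m'"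
  unfolding count_def by (rule sum_mono2) auto

lemma count_diff_le: "count j u (m + h) \<le> count j u m + real h"
  by (induction h) (auto simp: count_def)

text \<open>Counts and compensators are both non-decreasing, so control on a grid is control everywhere.\<close>
lemma mart_between_grid:
  assumes j: "j < K" and h: "h > 0"
    and grid: "\<And>g. g \<le> G \<Longrightarrow> \<bar>mart j u e (g * h)\<bar> \<le> c"
    and m: "m \<le> G * h"
  shows "\<bar>mart j u e m\<bar> \<le> real h + c"
\<comment> \<open>The last grid point has no right neighbour; every smaller index lies in a block
  from \<open>g * h\<close> to \<open>g * h + h\<close> with \<open>g < G\<close>.\<close>
proof (cases "m = G * h")
  case True
  then show ?thesis using grid[of G] by simp
next
  case False
  define g where "g = m div h"
  have "m = g * h + m mod h" by (simp add: g_def)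
  then have g: "g * h \<le> m" "m \<le> g * h + h"
    using mod_less_divisor[OF h, of m] by linarith+
  have "g < G"
    unfolding g_def using m False by (intro less_mult_imp_div_less) simp
  note g = g this
  have "\<bar>mart j u e (g * h)\<bar> \<le> c" "\<bar>mart j u e (g * h + h)\<bar> \<le> c"
    using grid[of g] grid[of "Suc g"] g by (auto simp: add.commute)
  then show ?thesis
    using count_mono[OF g(1), of j] count_mono[OF g(2), of j] count_diff_le[of j "g * h" h]
      compensator_mono[OF j g(1)] compensator_mono[OF j g(2)]
    unfolding mart_eq abs_le_iff by linarith
qed

section \<open>Late jump times and tracking of the path\<close>

lemma sum_count: "(\<Sum>j<K. count j u m) = real m"
proof -
  have "(\<Sum>j<K. count j u m) = (\<Sum>l<m. \<Sum>j<K. of_bool (pick K r (state u l) (u l) = j))"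
    unfolding count_def by (rule sum.swap)
  also have "\<dots> = (\<Sum>l<m. 1)"
    using pick_eq_iff(1)[OF noise(1,2)] by (intro sum.cong) (auto simp: of_bool_def)
  finally show ?thesis by simp
qed

lemma sum_compensator: "(\<Sum>j<K. compensator j u e m) = (\<Sum>l<m. e l)"
proof -
  have "(\<Sum>j<K. compensator j u e m) = (\<Sum>l<m. \<Sum>j<K. r (state u l) j / total (state u l) * e l)"
    unfolding compensator_def by (rule sum.swap)
  also have "\<dots> = (\<Sum>l<m. e l)"
    using total_pos
    by (intro sum.cong) (auto simp: less_imp_neq[THEN not_sym] simp flip: sum_distrib_right sum_divide_distrib)
  finally show ?thesis .
qed

text \<open>Turns a large sum of holding variables into a late jump time: this is how explosion is
  ruled out before the time horizon.\<close>

lemma sum_holding_le: "(\<Sum>l<m. e l) \<le> R * time m"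
proof (induction m)
  case (Suc m)
  have "e m = total (state u m) * (e m / total (state u m))"
    using total_pos[of "state u m"] by simp
  also have "\<dots> \<le> R * (e m / total (state u m))"
    using total_le[of "state u m"] noise(3)[of m] total_pos[of "state u m"]
    by (intro mult_right_mono) auto
  finally show ?case using Suc by (simp add: distrib_left)
qed simp

text \<open>Summed over all kinds, the compensated counts become the number of jumps minus the sum
  of the holding variables. Control at the last grid point therefore already forces that sum to be
  large, and no separate law of large numbers for holding times is involved. The \<open>+ 1\<close>
  arises because \<open>t\<close> lies between two jumps: the integrated rate is sandwiched between
  consecutive compensators, whose counts differ by at most 1.\<close>

lemma path_tracks_integrated_rates:
  assumes h: "h > 0"
    and grid: "\<And>j g. j < K \<Longrightarrow> g \<le> G \<Longrightarrow> \<bar>mart j u e (g * h)\<bar> \<le> c"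
    and \<tau>: "R * \<tau> < real (G * h) - real K * c"
  shows "\<tau> < time (G * h)"
    and "0 \<le> t \<Longrightarrow> t \<le> \<tau> \<Longrightarrow> \<exists>m. path t = state u m \<and>
      (\<forall>j<K. \<bar>count j u m - integrated_rate (G * h) j t\<bar> \<le> real h + c + 1)"
proof -
  have R: "0 < R" using total_pos[of x0] total_le[of x0] by linarith
  have "(\<Sum>j<K. mart j u e (G * h)) \<le> real K * c"
    using sum_bounded_above[of "{..<K}" "\<lambda>j. mart j u e (G * h)" c] grid[of _ G]
    by (auto simp: abs_le_iff)
  then have "real (G * h) - real K * c \<le> (\<Sum>l<G * h. e l)"
    unfolding mart_eq sum_subtractf sum_count sum_compensator by linarith
  also have "\<dots> \<le> R * time (G * h)" by (rule sum_holding_le)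
  finally have "R * \<tau> < R * time (G * h)" using \<tau> by linarith
  then show \<tau>': "\<tau> < time (G * h)" using R by simp
  assume t: "0 \<le> t" "t \<le> \<tau>"
  then have "t < time (G * h)" using \<tau>' by linarith
  with t obtain m where m: "m < G * h" "time m \<le> t" "t < time (Suc m)"
    using obtain_jump by blast
  have "\<bar>count j u m - integrated_rate (G * h) j t\<bar> \<le> real h + c + 1" if j: "j < K" for j
  proof -
    have b: "\<bar>mart j u e m\<bar> \<le> real h + c" "\<bar>mart j u e (Suc m)\<bar> \<le> real h + c"
      using mart_between_grid[OF j h grid[OF j], of G] m(1) by auto
    have "compensator j u e m \<le> integrated_rate (G * h) j t"
      using integrated_rate_mono[OF j m(2), of "G * h"] m(1) by (simp add: integrated_rate_at_jump del: jtime.simps)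
    moreover have "integrated_rate (G * h) j t \<le> compensator j u e (Suc m)"
      using integrated_rate_mono[OF j less_imp_le[OF m(3)], of "G * h"] m(1)
      by (simp add: integrated_rate_at_jump del: jtime.simps)
    moreover have "count j u m \<le> count j u (Suc m)" "count j u (Suc m) \<le> count j u m + 1"
      using count_mono[of m "Suc m" j] count_diff_le[of j m 1] by auto
    ultimately show ?thesis
      using b unfolding mart_eq abs_le_iff by linarith
  qed
  then show "\<exists>m. path t = state u m \<and>
      (\<forall>j<K. \<bar>count j u m - integrated_rate (G * h) j t\<bar> \<le> real h + c + 1)"
    using path_eq_state[OF m(2,3)] by blast
qed

end

section \<open>Compactness and density points\<close>

lemma eventually_nhds_coordinates:
  fixes x :: "'i \<Rightarrow> real"
  assumes "finite T" "\<epsilon> > 0"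
  shows "\<forall>\<^sub>F y in nhds x. \<forall>q\<in>T. \<bar>y q - x q\<bar> < \<epsilon>"
proof (rule eventually_ball_finite[OF assms(1)], rule ballI)
  fix q
  have "open ((\<lambda>y. y q) -` {x q - \<epsilon> <..< x q + \<epsilon>})"
    using continuous_on_product_coordinates[of q] by (intro open_vimage) auto
  then show "\<forall>\<^sub>F y in nhds x. \<bar>y q - x q\<bar> < \<epsilon>"
    unfolding eventually_nhds using assms(2) by (intro exI conjI) auto
qed

text \<open>Tychonoff on an arbitrary index set. The product topology need not be first countable,
  so a cluster point need not be the limit of a subsequence; what remains is repeated approximation
  on finite sets, which equicontinuity later upgrades.\<close>

lemma sequence_cluster_function:
  fixes g :: "nat \<Rightarrow> 'i \<Rightarrow> real"
  assumes "\<And>m q. \<bar>g m q\<bar> \<le> b q"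
  obtains x where "\<And>T \<epsilon> N. finite T \<Longrightarrow> \<epsilon> > 0 \<Longrightarrow> \<exists>m\<ge>N. \<forall>q\<in>T. \<bar>g m q - x q\<bar> < \<epsilon>"
proof -
  let ?U = "PiE UNIV (\<lambda>q. {- b q .. b q})"
  have "compactin (product_topology (\<lambda>_. euclidean) UNIV) ?U"
    unfolding compactin_PiE by (auto simp: compactin_euclidean_iff)
  then have "compact ?U"
    by (simp add: euclidean_product_topology compactin_euclidean_iff)
  moreover have "filtermap g sequentially \<noteq> bot"
    by (simp add: filtermap_bot_iff)
  moreover have "\<forall>\<^sub>F y in filtermap g sequentially. y \<in> ?U"
    unfolding eventually_filtermap
    using assms by (intro always_eventually) (auto simp: PiE_def abs_le_iff minus_le_iff)
  ultimately obtain x where x: "inf (nhds x) (filtermap g sequentially) \<noteq> bot"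
    unfolding compact_filter by blast
  show ?thesis
  proof (rule that)
    fix T :: "'i set" and \<epsilon> :: real and N :: nat
    assume T: "finite T" "\<epsilon> > 0"
    have "\<forall>\<^sub>F y in filtermap g sequentially. \<exists>m\<ge>N. y = g m"
      unfolding eventually_filtermap using eventually_ge_at_top[of N] by eventually_elim auto
    from eventually_conj[OF filter_leD[OF inf_le1 eventually_nhds_coordinates[OF T, of x]]
        filter_leD[OF inf_le2 this]]
    have "\<forall>\<^sub>F y in inf (nhds x) (filtermap g sequentially).
      (\<forall>q\<in>T. \<bar>y q - x q\<bar> < \<epsilon>) \<and> (\<exists>m\<ge>N. y = g m)" .
    from eventually_happens'[OF x this] show "\<exists>m\<ge>N. \<forall>q\<in>T. \<bar>g m q - x q\<bar> < \<epsilon>"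
      by auto
  qed
qed

text \<open>Arzela-Ascoli for all time horizons at once: tying the interval and the error to the
  same index \<open>m\<close> replaces a diagonal argument. The map \<open>r\<close> need not be
  increasing, since \<open>m \<le> r m\<close> already makes it tend to infinity.\<close>

lemma lipschitz_locally_uniform_limit:
  fixes D :: "nat \<Rightarrow> 'i \<Rightarrow> real \<Rightarrow> real"
  assumes I: "finite I"
    and lip: "\<And>m i. i \<in> I \<Longrightarrow> R-lipschitz_on {0..} (D m i)"
    and zero: "\<And>m i. i \<in> I \<Longrightarrow> D m i 0 = 0"
  obtains F r where "\<And>m. m \<le> r m"
    "\<And>m i t. i \<in> I \<Longrightarrow> 0 \<le> t \<Longrightarrow> t \<le> real m \<Longrightarrow> \<bar>D (r m) i t - F i t\<bar> \<le> 1 / real (Suc m)"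
proof (cases "I = {}")
  case True
  then show ?thesis using that[of "\<lambda>m. m"] by auto
next
  case False
  then have R: "0 \<le> R" using lip lipschitz_on_nonneg by blast
  define g where "g m = (\<lambda>(i, t). if i \<in> I \<and> 0 \<le> t then D m i t else 0)" for m
  have Dlip: "\<bar>D m i s - D m i t\<bar> \<le> R * \<bar>s - t\<bar>" if "i \<in> I" "0 \<le> s" "0 \<le> t" for m i s t
    using lipschitz_onD[OF lip[OF that(1)], of s t m] that by (simp add: dist_real_def)
  have "\<bar>g m (i, t)\<bar> \<le> R * \<bar>t\<bar>" for m i t
    using Dlip[of i t 0 m] zero[of i m] R by (auto simp: g_def)
  then have "\<bar>g m q\<bar> \<le> (\<lambda>(i, t). R * \<bar>t\<bar>) q" for m q
    by (cases q) simp
  then obtain x where x: "\<And>T \<epsilon> N. finite T \<Longrightarrow> \<epsilon> > 0 \<Longrightarrow> \<exists>m\<ge>N. \<forall>q\<in>T. \<bar>g m q - x q\<bar> < \<epsilon>"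
    using sequence_cluster_function[of g] by blast
  have xlip: "\<bar>x (i, s) - x (i, t)\<bar> \<le> R * \<bar>s - t\<bar>" if "i \<in> I" "0 \<le> s" "0 \<le> t" for i s t
  proof (rule field_le_epsilon)
    fix \<epsilon> :: real assume "\<epsilon> > 0"
    then obtain m where "\<forall>q\<in>{(i, s), (i, t)}. \<bar>g m q - x q\<bar> < \<epsilon> / 2"
      using x[of "{(i, s), (i, t)}" "\<epsilon> / 2" 0] by auto
    then have "\<bar>D m i s - x (i, s)\<bar> < \<epsilon> / 2" "\<bar>D m i t - x (i, t)\<bar> < \<epsilon> / 2"
      using that by (auto simp: g_def)
    then show "\<bar>x (i, s) - x (i, t)\<bar> \<le> R * \<bar>s - t\<bar> + \<epsilon>"
      using Dlip[OF that, of m] by linarith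
  qed
  have "\<exists>k\<ge>m. \<forall>i\<in>I. \<forall>t. 0 \<le> t \<and> t \<le> real m \<longrightarrow> \<bar>D k i t - x (i, t)\<bar> \<le> 1 / real (Suc m)" for m
  proof -
    define \<epsilon> where "\<epsilon> = 1 / real (Suc m)"
    have \<epsilon>: "\<epsilon> > 0" by (simp add: \<epsilon>_def)
    \<comment> \<open>Moving to a grid point of mesh \<eta> costs a third of \<epsilon> for
      \<open>D k\<close> and a third for the limit; the last third is the error at the grid point.
      The \<open>+ 1\<close> covers \<open>R = 0\<close>.\<close>
    define \<eta> where "\<eta> = \<epsilon> / (3 * (R + 1))"
    have \<eta>: "\<eta> > 0" "R * \<eta> \<le> \<epsilon> / 3"
      using R \<epsilon> by (auto simp: \<eta>_def field_simps)
    define T where "T = I \<times> ((\<lambda>k. real k * \<eta>) ` {..nat \<lceil>real m / \<eta>\<rceil>})"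
    have "finite T" using I by (simp add: T_def)
    then obtain k where k: "k \<ge> m" "\<forall>q\<in>T. \<bar>g k q - x q\<bar> < \<epsilon> / 3"
      using x[of T "\<epsilon> / 3" m] \<epsilon> by auto
    have "\<bar>D k i t - x (i, t)\<bar> \<le> \<epsilon>" if i: "i \<in> I" and t: "0 \<le> t" "t \<le> real m" for i t
    proof -
      define j where "j = nat \<lfloor>t / \<eta>\<rfloor>"
      have "real j = of_int \<lfloor>t / \<eta>\<rfloor>"
        unfolding j_def using t \<eta> by simp
      then have "real j \<le> t / \<eta>" "t / \<eta> < real j + 1" by linarith+
      then have j: "real j * \<eta> \<le> t" "t \<le> real j * \<eta> + \<eta>"
        using \<eta> by (auto simp: field_simps)
      have "t / \<eta> \<le> real m / \<eta>" using t \<eta> by (intro divide_right_mono) auto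
      then have "j \<le> nat \<lceil>real m / \<eta>\<rceil>"
        using \<open>real j \<le> t / \<eta>\<close> by linarith
      then have "(i, real j * \<eta>) \<in> T" using i by (auto simp: T_def)
      then have 1: "\<bar>D k i (real j * \<eta>) - x (i, real j * \<eta>)\<bar> < \<epsilon> / 3"
        using k(2) i \<eta>(1) by (force simp: g_def)
      have d: "R * \<bar>t - real j * \<eta>\<bar> \<le> \<epsilon> / 3"
      proof -
        have "R * \<bar>t - real j * \<eta>\<bar> \<le> R * \<eta>" using j R by (intro mult_left_mono) auto
        then show ?thesis using \<eta> by linarith
      qed
      have "0 \<le> real j * \<eta>" using \<eta> by simp
      then show ?thesis
        using 1 d Dlip[OF i t(1), of "real j * \<eta>" k] xlip[OF i t(1), of "real j * \<eta>"]
        by linarith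
    qed
    then show ?thesis using k(1) unfolding \<epsilon>_def by blast
  qed
  then obtain r where "\<And>m. m \<le> r m \<and> (\<forall>i\<in>I. \<forall>t. 0 \<le> t \<and> t \<le> real m \<longrightarrow> \<bar>D (r m) i t - x (i, t)\<bar> \<le> 1 / real (Suc m))"
    by metis
  then show ?thesis by (intro that[of r "\<lambda>i t. x (i, t)"]) auto
qed

text \<open>Almost everywhere in \<open>Z\<close> the averages of its indicator over
  \<open>[t, t + h]\<close> tend to 1. A gap of length \<open>e * h\<close> at the right end would
  push the average down to \<open>1 - e\<close>.\<close>

lemma AE_right_density_point:
  fixes Z :: "real set"
  assumes Z: "Z \<in> sets lebesgue"
  shows "AE t in lebesgue. t \<in> Z \<longrightarrow> (\<forall>e>0. \<exists>d>0. \<forall>h. 0 < h \<and> h < d \<longrightarrow> (\<exists>z\<in>Z. t + h - e * h \<le> z \<and> z \<le> t + h))"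
proof -
  have Zab: "Z \<inter> cbox a b \<in> lmeasurable" for a b
    using Z by (metis inf.commute fmeasurable_Int_fmeasurable lmeasurable_cbox)
  have "indicat_real Z integrable_on cbox a b" for a b
    using Zab by (simp add: integrable_on_indicator)
  then obtain N where N: "negligible N"
    "\<And>x e. \<lbrakk>x \<notin> N; 0 < e\<rbrakk> \<Longrightarrow> \<exists>d>0. \<forall>h. 0 < h \<and> h < d \<longrightarrow>
        norm (integral (cbox x (x + h *\<^sub>R One)) (indicat_real Z) /\<^sub>R h ^ DIM(real) - indicat_real Z x) < e"
    using integrable_ccontinuous_explicit[of "indicat_real Z"] by blast
  have *: "\<exists>d>0. \<forall>h. 0 < h \<and> h < d \<longrightarrow> (\<exists>z\<in>Z. t + h - e * h \<le> z \<and> z \<le> t + h)"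
    if t: "t \<in> Z" "t \<notin> N" and e: "0 < e" for t e
  proof -
    \<comment> \<open>The cap at 1 keeps \<open>h - e' * h\<close> nonnegative, so that it is the
      length of an interval.\<close>
    define e' where "e' = min e 1"
    have e': "0 < e'" "e' \<le> e" "e' \<le> 1" using e by (auto simp: e'_def)
    obtain d where d: "d > 0" "\<And>h. 0 < h \<Longrightarrow> h < d \<Longrightarrow>
        \<bar>integral {t..t + h} (indicat_real Z) / h - 1\<bar> < e'"
      using N(2)[OF t(2) e'(1)] t(1) by (auto simp: divide_inverse mult.commute)
    have "\<exists>z\<in>Z. t + h - e * h \<le> z \<and> z \<le> t + h" if h: "0 < h" "h < d" for h
    proof (rule ccontr)
      assume no: "\<not> ?thesis"
      have "e' * h \<le> e * h" using e' h by (intro mult_right_mono) auto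
      then have sub: "Z \<inter> {t..t + h} \<subseteq> {t..t + h - e' * h}"
        using no by force
      have "integral {t..t + h} (indicat_real Z) = measure lebesgue (Z \<inter> {t..t + h})"
        using Henstock_Kurzweil_Integration.integral_unique Zab[of t "t + h"]
        by (simp add: Equivalence_Lebesgue_Henstock_Integration.integral_indicator)
      also have "\<dots> \<le> measure lebesgue {t..t + h - e' * h}"
        using sub Zab[of t "t + h"] by (intro measure_mono_fmeasurable) auto
      also have "\<dots> = h - e' * h"
        using e' h by (simp add: mult_left_le_one_le)
      finally have "integral {t..t + h} (indicat_real Z) / h \<le> (h - e' * h) / h"
        using h by (intro divide_right_mono) auto
      also have "\<dots> = 1 - e'" using h by (simp add: diff_divide_distrib)
      finally show False using d(2)[OF h] by linarith
    qed
    then show ?thesis using d(1) by blast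
  qed
  have "AE t in lebesgue. t \<notin> N"
    using N(1) by (simp add: negligible_iff_null_sets AE_not_in)
  then show ?thesis
    by eventually_elim (use * in blast)
qed

text \<open>The left-hand half is the right-hand statement for the reflected set, as Lebesgue
  measure is invariant under \<open>uminus\<close>.\<close>

lemma AE_density_point:
  fixes Z :: "real set"
  assumes Z: "Z \<in> sets borel"
  shows "AE t in lborel. t \<in> Z \<longrightarrow> (\<forall>e>0. \<exists>d>0. \<forall>y. \<bar>y - t\<bar> < d \<longrightarrow> (\<exists>z\<in>Z. \<bar>y - z\<bar> \<le> e * \<bar>y - t\<bar>))"
proof -
  let ?P = "\<lambda>Z t. t \<in> Z \<longrightarrow> (\<forall>e>0. \<exists>d>0. \<forall>h. 0 < h \<and> h < d \<longrightarrow> (\<exists>z\<in>Z. t + h - e * h \<le> z \<and> z \<le> t + h))"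
  have lb: "AE t in lborel. ?P S t" if "S \<in> sets borel" for S :: "real set"
    using AE_right_density_point[of S] that by (simp add: AE_completion_iff sets_completionI_sets)
  let ?Z' = "uminus -` Z"
  have Z': "?Z' \<in> sets borel"
    using Z measurable_sets_borel[of uminus borel Z] by simp
  have "AE t in distr lborel borel uminus. ?P ?Z' t"
    by (subst lborel_distr_uminus) (rule lb[OF Z'])
  then have "AE t in lborel. ?P ?Z' (- t)"
    by (rule AE_distrD[rotated]) simp
  with lb[OF Z] show ?thesis
  proof eventually_elim
    case (elim t)
    show ?case
    proof (intro impI allI)
      fix e :: real assume tZ: "t \<in> Z" and e: "e > 0"
      obtain d1 where d1: "d1 > 0" "\<And>h. 0 < h \<Longrightarrow> h < d1 \<Longrightarrow> \<exists>z\<in>Z. t + h - e * h \<le> z \<and> z \<le> t + h"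
        using elim(1) tZ e by blast
      obtain d2 where d2: "d2 > 0" "\<And>h. 0 < h \<Longrightarrow> h < d2 \<Longrightarrow> \<exists>z\<in>?Z'. - t + h - e * h \<le> z \<and> z \<le> - t + h"
        using elim(2) tZ e by (auto simp del: vimage_eq)
      have "\<exists>z\<in>Z. \<bar>y - z\<bar> \<le> e * \<bar>y - t\<bar>" if y: "\<bar>y - t\<bar> < min d1 d2" for y
      proof -
        consider "y = t" | "y > t" | "y < t" by linarith
        then show ?thesis
        proof cases
          case 1 then show ?thesis using tZ by (intro bexI[of _ t]) auto
        next
          case 2
          then obtain z where "z \<in> Z" "t + (y - t) - e * (y - t) \<le> z" "z \<le> t + (y - t)"
            using d1(2)[of "y - t"] y by auto
          then show ?thesis using 2 by (intro bexI[of _ z]) auto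
        next
          case 3
          then obtain z where "- z \<in> Z" "- t + (t - y) - e * (t - y) \<le> z" "z \<le> - t + (t - y)"
            using d2(2)[of "t - y"] y by auto
          then show ?thesis using 3 by (intro bexI[of _ "- z"]) auto
        qed
      qed
      then show "\<exists>d>0. \<forall>y. \<bar>y - t\<bar> < d \<longrightarrow> (\<exists>z\<in>Z. \<bar>y - z\<bar> \<le> e * \<bar>y - t\<bar>)"
        using d1(1) d2(1) by (intro exI[of _ "min d1 d2"]) auto
    qed
  qed
qed

lemma has_real_derivative_sandwich:
  fixes f :: "real \<Rightarrow> real"
  assumes "\<And>e. e > 0 \<Longrightarrow> \<exists>d>0. \<forall>y. \<bar>y - t\<bar> < d \<longrightarrow> \<bar>f y - f t - c * (y - t)\<bar> \<le> e * \<bar>y - t\<bar>"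
  shows "(f has_real_derivative c) (at t)"
  unfolding has_field_derivative_def has_derivative_at_alt
  using assms by (auto intro: bounded_linear_mult_right)

text \<open>Near a density point \<open>t\<close>, every \<open>y\<close> has a zero of
  \<open>f\<close> at a distance that is small compared with \<open>\<bar>y - t\<bar>\<close>, and
  the Lipschitz bound carries this over to \<open>f y\<close>. Taking
  \<open>\<bar>y - t\<bar> < t\<close> keeps \<open>y\<close> in the half-line where
  \<open>f\<close> is Lipschitz.\<close>

lemma AE_lipschitz_derivative_on_zeros:
  fixes f :: "real \<Rightarrow> real"
  assumes Z: "Z \<in> sets borel" "\<And>z. z \<in> Z \<Longrightarrow> 0 \<le> z \<and> f z = 0"
    and lip: "B-lipschitz_on {0..} f"
  shows "AE t in lborel. t > 0 \<and> t \<in> Z \<longrightarrow> (f has_real_derivative 0) (at t)"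
  using AE_density_point[OF Z(1)]
proof eventually_elim
  case (elim t)
  have B: "0 \<le> B" by (rule lipschitz_on_nonneg[OF lip])
  show ?case
  proof (intro impI has_real_derivative_sandwich)
    fix e :: real assume t: "0 < t \<and> t \<in> Z" and e: "e > 0"
    define e' where "e' = e / (B + 1)"
    have e': "e' > 0" "B * e' \<le> e" using B e by (auto simp: e'_def field_simps)
    obtain d where d: "d > 0" "\<And>y. \<bar>y - t\<bar> < d \<Longrightarrow> \<exists>z\<in>Z. \<bar>y - z\<bar> \<le> e' * \<bar>y - t\<bar>"
      using elim t e' by blast
    have "\<bar>f y\<bar> \<le> e * \<bar>y - t\<bar>" if y: "\<bar>y - t\<bar> < min d t" for y
    proof -
      obtain z where z: "z \<in> Z" "\<bar>y - z\<bar> \<le> e' * \<bar>y - t\<bar>" using d(2)[of y] y by auto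
      have "\<bar>f y - f z\<bar> \<le> B * \<bar>y - z\<bar>"
        using lipschitz_onD[OF lip, of y z] y Z(2)[OF z(1)] by (auto simp: dist_real_def)
      also have "\<dots> \<le> B * (e' * \<bar>y - t\<bar>)" using z(2) B by (intro mult_left_mono)
      also have "\<dots> \<le> e * \<bar>y - t\<bar>"
        using e' by (simp add: mult_right_mono flip: mult.assoc)
      finally show ?thesis using Z(2)[OF z(1)] by simp
    qed
    then show "\<exists>d>0. \<forall>y. \<bar>y - t\<bar> < d \<longrightarrow> \<bar>f y - f t - 0 * (y - t)\<bar> \<le> e * \<bar>y - t\<bar>"
      using d(1) t Z(2)[of t] by (intro exI[of _ "min d t"]) auto
  qed
qed

section \<open>Interference weights and departure rates\<close>

lemma tdist_self: "tdist Q b b = 0"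
proof -
  have "tdist1 Q v v = 0" for v
    unfolding tdist1_def by (rule cInf_eq_minimum) (auto intro: exI[of _ 0])
  then show ?thesis by (simp add: tdist_def)
qed

lemma tdist_nonneg: "0 \<le> tdist Q b b'"
  by (simp add: tdist_def)

text \<open>The walk follows the row of \<open>i0\<close> to column 0 and out to the column of
  \<open>i\<close>, then proceeds likewise inside that column; every step changes one coordinate by
  1.\<close>

lemma grid_connected:
  fixes m :: nat
  assumes i0: "i0 < m\<^sup>2" "P i0"
    and step: "\<And>i i'. \<lbrakk>i < m\<^sup>2; i' < m\<^sup>2; P i;
      \<bar>real (i mod m) - real (i' mod m)\<bar> \<le> 1; \<bar>real (i div m) - real (i' div m)\<bar> \<le> 1\<rbrakk> \<Longrightarrow> P i'"
    and i: "i < m\<^sup>2"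
  shows "P i"
proof -
  have m: "m > 0" using i by (cases m) auto
  have step': "P (p' + m * q')"
    if "P (p + m * q)" "p < m" "q < m" "p' < m" "q' < m"
      "\<bar>real p - real p'\<bar> \<le> 1" "\<bar>real q - real q'\<bar> \<le> 1" for p q p' q'
  proof (rule step[of "p + m * q"])
    have lt: "p + m * q < m\<^sup>2" if "p < m" "q < m" for p q
    proof -
      have "p + m * q < m * Suc q" using that by simp
      also have "\<dots> \<le> m * m" using that by (intro mult_le_mono2) simp
      finally show ?thesis by (simp add: power2_eq_square)
    qed
    show "p + m * q < m\<^sup>2" "p' + m * q' < m\<^sup>2" using that lt by auto
  qed (use that in auto)
  have row: "P (p' + m * q)" if P: "P (p + m * q)" and pq: "p < m" "q < m" "p' < m" for p q p'
  proof -
    have "p < m \<Longrightarrow> P (p + m * q) \<Longrightarrow> P (0 + m * q)"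
    proof (induction p)
      case (Suc p)
      then show ?case using step'[of "Suc p" q p q] pq by simp
    qed simp
    then have 0: "P (0 + m * q)" using P pq by simp
    have "p' < m \<Longrightarrow> P (p' + m * q)" for p'
    proof (induction p')
      case (Suc p')
      then show ?case using step'[of p' q "Suc p'" q] pq by simp
    qed (use 0 in simp)
    then show ?thesis using pq by simp
  qed
  have column: "P (p + m * q')" if P: "P (p + m * q)" and pq: "p < m" "q < m" "q' < m" for p q q'
  proof -
    have "q < m \<Longrightarrow> P (p + m * q) \<Longrightarrow> P (p + m * 0)"
    proof (induction q)
      case (Suc q)
      then show ?case using step'[of p "Suc q" p q] pq by simp
    qed simp
    then have 0: "P (p + m * 0)" using P pq by simp
    have "q' < m \<Longrightarrow> P (p + m * q')" for q'
    proof (induction q')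
      case (Suc q')
      then show ?case using step'[of p q' p "Suc q'"] pq by simp
    qed (use 0 in simp)
    then show ?thesis using pq by simp
  qed
  have decomp: "i mod m < m" "i div m < m" "i mod m + m * (i div m) = i" if "i < m\<^sup>2" for i
    using that m less_mult_imp_div_less[of i m m] by (auto simp: power2_eq_square)
  have "P (i0 mod m + m * (i0 div m))" using i0 decomp(3)[of i0] by simp
  then have "P (i mod m + m * (i0 div m))" 
    by (rule row) (use decomp(1,2) i i0(1) in auto)
  then have "P (i mod m + m * (i div m))" 
    by (rule column) (use decomp(1,2) i i0(1) in auto)
  then show ?thesis using decomp(3)[OF i] by simp
qed

text \<open>Used with \<open>v = N0 + (S - 1)\<close> for the interference \<open>S\<close>: both
  bounds are \<open>1 / S\<close> up to a bounded shift of the denominator, which scaling makes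
  negligible. The lower one is \<open>ln y \<le> y - 1\<close> at
  \<open>y = v / (v + 1)\<close>.\<close>

lemma ln_one_plus_inverse_bounds:
  fixes v :: real
  assumes "v > 0"
  shows "ln (1 + 1 / v) \<le> 1 / v" and "1 / (v + 1) \<le> ln (1 + 1 / v)"
proof -
  show "ln (1 + 1 / v) \<le> 1 / v"
    using assms by (intro ln_add_one_self_le_self) auto
  have "ln (v / (v + 1)) \<le> v / (v + 1) - 1"
    using assms by (intro ln_le_minus_one) auto
  moreover have "ln (v / (v + 1)) = - ln (1 + 1 / v)"
    using assms by (subst ln_inverse[symmetric]) (auto simp: field_simps)
  moreover have "v / (v + 1) - 1 = - (1 / (v + 1))"
    using assms by (simp add: field_simps)
  ultimately show "1 / (v + 1) \<le> ln (1 + 1 / v)" by linarith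
qed

lemma sum_lessThan_add:
  fixes f :: "nat \<Rightarrow> real"
  shows "(\<Sum>k<n + m. f k) = (\<Sum>k<n. f k) + (\<Sum>k<m. f (n + k))"
  by (induction m) simp_all

locale network =
  fixes Q eps N0 C L lam :: real and l :: "real \<Rightarrow> real"
  assumes Q_pos: "Q > 0" and admissible: "admissible Q eps"
    and N0_pos: "N0 > 0" and C_pos: "C > 0" and L_pos: "L > 0" and lam_pos: "lam > 0"
    and l_0: "l 0 = 1" and l_nonneg: "\<forall>r\<ge>0. l r \<ge> 0"
    and l_antimono: "\<forall>r r'. 0 \<le> r \<longrightarrow> r \<le> r' \<longrightarrow> l r' \<le> l r"
begin

abbreviation n :: nat where "n \<equiv> ncells Q eps"
abbreviation a :: real where "a \<equiv> lam * eps\<^sup>2"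
abbreviation w :: "nat \<Rightarrow> nat \<Rightarrow> real" where "w \<equiv> leps Q eps l"
abbreviation dep :: "(nat \<Rightarrow> nat) \<Rightarrow> nat \<Rightarrow> real" where "dep \<equiv> dep_rate Q eps l N0 C L"

definition c0 :: real where "c0 = C / (L * ln 2)"
text \<open>Bound on the total jump rate: \<open>n\<close> arrival rates and \<open>n\<close>
  departure rates, the latter by \<open>dep_range\<close>.\<close>

definition R :: real where "R = real n * a + real n * (c0 * (1 + 1 / N0))"

lemma eps_pos: "eps > 0"
  using admissible by (simp add: admissible_def)

lemma a_pos: "a > 0"
  using eps_pos lam_pos by simp

lemma c0_pos: "c0 > 0"
  using C_pos L_pos by (simp add: c0_def)

lemma n_pos: "n > 0"
proof -
  obtain m :: nat where m: "2 * Q / eps = real m" using admissible by (auto simp: admissible_def)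
  have "2 * Q / eps > 0" using Q_pos eps_pos by simp
  then show ?thesis using m by (simp add: ncells_def side_def)
qed

lemma l_tdist_range: "0 \<le> l (tdist Q b b')" "l (tdist Q b b') \<le> 1"
proof -
  show "0 \<le> l (tdist Q b b')" using l_nonneg tdist_nonneg by blast
  have "l (tdist Q b b') \<le> l 0" using l_antimono tdist_nonneg by blast
  then show "l (tdist Q b b') \<le> 1" by (simp add: l_0)
qed

lemma weight_range: "0 \<le> w i j" "w i j \<le> 1"
proof -
  let ?S = "{l (tdist Q b b') | b b'. b \<in> cell Q eps i \<and> b' \<in> cell Q eps j}"
  have c: "center Q eps i \<in> cell Q eps i" for i using eps_pos by (simp add: cell_def)
  have le: "s \<le> 1" and ge: "0 \<le> s" if "s \<in> ?S" for s
    using that by (auto simp: l_tdist_range)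
  have e: "l (tdist Q (center Q eps i) (center Q eps j)) \<in> ?S" using c by blast
  show "w i j \<le> 1" unfolding leps_def by (rule cSup_least) (use e le in blast)+
  have "l (tdist Q (center Q eps i) (center Q eps j)) \<le> w i j"
    unfolding leps_def by (rule cSup_upper[OF e]) (use le in \<open>unfold bdd_above_def, blast\<close>)
  then show "0 \<le> w i j" using ge[OF e] by linarith
qed

lemma weight_shared_point:
  assumes "b \<in> cell Q eps i" "b \<in> cell Q eps j"
  shows "w i j = 1"
proof (rule antisym[OF weight_range(2)])
  let ?S = "{l (tdist Q b b') | b b'. b \<in> cell Q eps i \<and> b' \<in> cell Q eps j}"
  have "l (tdist Q b b) \<in> ?S" using assms by blast
  moreover have "bdd_above ?S"
    unfolding bdd_above_def by (auto intro!: exI[of _ 1] simp: l_tdist_range)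
  ultimately have "l (tdist Q b b) \<le> Sup ?S" by (rule cSup_upper)
  then show "1 \<le> w i j" by (simp add: leps_def tdist_self l_0)
qed

lemma weight_self: "w i i = 1"
  by (rule weight_shared_point[of "center Q eps i"]) (use eps_pos in \<open>auto simp: cell_def\<close>)

lemma weight_adjacent:
  assumes "\<bar>real (i mod side Q eps) - real (i' mod side Q eps)\<bar> \<le> 1"
    and "\<bar>real (i div side Q eps) - real (i' div side Q eps)\<bar> \<le> 1"
  shows "w i i' = 1"
proof -
  \<comment> \<open>The midpoint of two neighbouring centres lies in both closed cells; for diagonal
    neighbours it is their common corner.\<close>
  define mid where "mid x y = (x + y) / 2 * eps" for x y
  have mid: "\<bar>mid x y - x * eps\<bar> \<le> eps / 2" "\<bar>mid x y - y * eps\<bar> \<le> eps / 2" if "\<bar>x - y\<bar> \<le> 1" for x y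
  proof -
    have "mid x y - x * eps = (y - x) / 2 * eps" "mid x y - y * eps = (x - y) / 2 * eps"
      by (simp_all add: mid_def field_simps)
    moreover have "\<bar>(y - x) / 2 * eps\<bar> \<le> 1 / 2 * eps" "\<bar>(x - y) / 2 * eps\<bar> \<le> 1 / 2 * eps"
      using that eps_pos unfolding abs_mult by (auto intro!: mult_mono)
    ultimately have "\<bar>mid x y - x * eps\<bar> \<le> 1 / 2 * eps" "\<bar>mid x y - y * eps\<bar> \<le> 1 / 2 * eps"
      by (simp_all only:)
    then show "\<bar>mid x y - x * eps\<bar> \<le> eps / 2" "\<bar>mid x y - y * eps\<bar> \<le> eps / 2" by simp_all
  qed
  show ?thesis
    by (rule weight_shared_point[of "(mid (real (i mod side Q eps)) (real (i' mod side Q eps)),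
          mid (real (i div side Q eps)) (real (i' div side Q eps)))"])
      (use mid[OF assms(1)] mid[OF assms(2)] in \<open>simp_all add: cell_def center_def\<close>)
qed

section \<open>Bounds on the departure rates\<close>

lemma interference_ge_self:
  assumes "i < n" "\<And>j. j < n \<Longrightarrow> 0 \<le> y j"
  shows "y i \<le> (\<Sum>j<n. y j * w i j)"
  using member_le_sum[of i "{..<n}" "\<lambda>j. y j * w i j"] assms weight_range weight_self[of i] by simp

lemma dep_eq:
  assumes i: "i < n"
  shows "dep X i = c0 * real (X i) * ln (1 + 1 / (N0 + ((\<Sum>j<n. real (X j) * w i j) - 1)))"
proof -
  have "(\<Sum>j<n. (real (X j) - (if j = i then 1 else 0)) * w i j)
    = (\<Sum>j<n. real (X j) * w i j) - (\<Sum>j<n. if j = i then w i j else 0)"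
    unfolding sum_subtractf[symmetric] by (intro sum.cong) (auto simp: left_diff_distrib)
  also have "(\<Sum>j<n. if j = i then w i j else 0) = 1"
    using i weight_self by simp
  finally show ?thesis by (simp add: dep_rate_def c0_def log_def)
qed

lemma dep_zero: "X i = 0 \<Longrightarrow> dep X i = 0"
  by (simp add: dep_rate_def)

lemma dep_bounds:
  assumes i: "i < n" and X: "0 < X i"
  defines "S \<equiv> \<Sum>j<n. real (X j) * w i j"
  shows "c0 * real (X i) / (N0 + S) \<le> dep X i" and "dep X i \<le> c0 * real (X i) / (N0 + (S - 1))"
    and "real (X i) \<le> S"
proof -
  show S: "real (X i) \<le> S"
    using interference_ge_self[OF i, of "\<lambda>j. real (X j)"] by (simp add: S_def)
  \<comment> \<open>An occupied cell contributes at least 1 to its own interference, which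
    compensates the \<open>- 1\<close>.\<close>
  then have v: "N0 + (S - 1) > 0" using N0_pos X by linarith
  have e: "dep X i = c0 * real (X i) * ln (1 + 1 / (N0 + (S - 1)))"
    unfolding S_def by (rule dep_eq[OF i])
  have 0: "0 \<le> c0 * real (X i)" using c0_pos by simp
  show "c0 * real (X i) / (N0 + S) \<le> dep X i"
    using mult_left_mono[OF ln_one_plus_inverse_bounds(2)[OF v] 0] by (simp add: e)
  show "dep X i \<le> c0 * real (X i) / (N0 + (S - 1))"
    using mult_left_mono[OF ln_one_plus_inverse_bounds(1)[OF v] 0] by (simp add: e)
qed

text \<open>The extreme case is \<open>S = X i\<close>. For \<open>X \<ge> 1\<close> the quotient
  \<open>X / (N0 + X - 1)\<close> is at most the larger of 1 and \<open>1 / N0\<close>, and the sum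
  of the two avoids a case distinction.\<close>

lemma dep_range:
  assumes i: "i < n"
  shows "0 \<le> dep X i" and "dep X i \<le> c0 * (1 + 1 / N0)"
proof -
  have "0 \<le> dep X i \<and> dep X i \<le> c0 * (1 + 1 / N0)"
  proof (cases "X i = 0")
    case True
    then show ?thesis using c0_pos N0_pos by (simp add: dep_zero)
  next
    case False
    then have X: "0 < X i" by simp
    define S where "S = (\<Sum>j<n. real (X j) * w i j)"
    note b = dep_bounds[of i X, OF i X, folded S_def]
    have v: "N0 + (S - 1) > 0" using b(3) X N0_pos by linarith
    have "real (X i) * N0 \<le> (N0 + 1) * (N0 + (real (X i) - 1))"
    proof -
      have "1 \<le> N0 * N0 + real (X i)" using X by (intro add_increasing) auto
      then show ?thesis by (simp add: algebra_simps)
    qed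
    also have "\<dots> \<le> (N0 + 1) * (N0 + (S - 1))"
      using b(3) N0_pos by (intro mult_left_mono) auto
    finally have "real (X i) / (N0 + (S - 1)) \<le> 1 + 1 / N0"
      using v N0_pos by (simp add: field_simps)
    then have "c0 * real (X i) / (N0 + (S - 1)) \<le> c0 * (1 + 1 / N0)"
      using mult_left_mono[of "real (X i) / (N0 + (S - 1))" "1 + 1 / N0" c0] c0_pos by simp
    moreover have "0 \<le> c0 * real (X i) / (N0 + S)"
      using b(3) N0_pos c0_pos by simp
    ultimately show ?thesis using b(1,2) by linarith
  qed
  then show "0 \<le> dep X i" "dep X i \<le> c0 * (1 + 1 / N0)" by auto
qed

text \<open>The departure rate is almost homogeneous of degree 0: after scaling, noise and
  self-interference enter only through \<open>N0 / z\<close> and \<open>1 / z\<close>.\<close>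

lemma dep_scaled_bounds:
  fixes z :: real and X :: "nat \<Rightarrow> nat"
  assumes i: "i < n" and z: "z > 0"
  defines "p \<equiv> \<lambda>j. real (X j) / z"
    and "\<sigma> \<equiv> \<Sum>j<n. real (X j) / z * w i j"
  shows "c0 * p i / (\<sigma> + N0 / z) \<le> dep X i"
    and "1 / z < \<sigma> \<Longrightarrow> dep X i \<le> c0 * p i / (\<sigma> - 1 / z)"
proof -
  define S where "S = (\<Sum>j<n. real (X j) * w i j)"
  have \<sigma>: "\<sigma> = S / z" by (simp add: \<sigma>_def S_def sum_divide_distrib)
  have S0: "0 \<le> S" unfolding S_def by (intro sum_nonneg mult_nonneg_nonneg) (auto simp: weight_range)
  have "c0 * p i / (\<sigma> + N0 / z) = c0 * real (X i) / (N0 + S)"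
    using z by (simp add: \<sigma> p_def add.commute flip: add_divide_distrib)
  then show "c0 * p i / (\<sigma> + N0 / z) \<le> dep X i"
    using dep_bounds(1)[OF i, of X] by (cases "X i = 0") (auto simp: dep_zero S_def)
  assume "1 / z < \<sigma>"
  then have S1: "1 < S" using z by (simp add: \<sigma> divide_less_cancel)
  have "c0 * p i / (\<sigma> - 1 / z) = c0 * real (X i) / (S - 1)"
    using z by (simp add: \<sigma> p_def flip: diff_divide_distrib)
  moreover have "c0 * real (X i) / (N0 + (S - 1)) \<le> c0 * real (X i) / (S - 1)"
    using S1 N0_pos c0_pos by (intro divide_left_mono) auto
  ultimately show "dep X i \<le> c0 * p i / (\<sigma> - 1 / z)"
    using dep_bounds(2)[OF i, of X] by (cases "X i = 0") (auto simp: dep_zero S_def p_def)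
qed

lemma chain_rate_arrival: "k < n \<Longrightarrow> chain_rate Q eps l N0 C L lam X k = a"
  by (simp add: chain_rate_def)

lemma chain_rate_departure: "chain_rate Q eps l N0 C L lam X (n + k) = dep X k"
  by (simp add: chain_rate_def)

lemma total_rate: "(\<Sum>k<2 * n. chain_rate Q eps l N0 C L lam X k) = real n * a + (\<Sum>k<n. dep X k)"
proof -
  have "(\<Sum>k<2 * n. chain_rate Q eps l N0 C L lam X k)
    = (\<Sum>k<n. chain_rate Q eps l N0 C L lam X k) + (\<Sum>k<n. chain_rate Q eps l N0 C L lam X (n + k))"
    unfolding mult_2 by (rule sum_lessThan_add)
  then show ?thesis by (simp add: chain_rate_arrival chain_rate_departure)
qed

lemma jump_chain: "jump_chain (2 * n) (chain_rate Q eps l N0 C L lam) R"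
proof
  fix X k
  show "0 \<le> chain_rate Q eps l N0 C L lam X k" if "k < 2 * n"
    using that a_pos dep_range(1)[of "k - n" X] by (auto simp: chain_rate_def)
  have "0 \<le> (\<Sum>k<n. dep X k)" by (intro sum_nonneg) (auto intro: dep_range)
  moreover have "real n * a > 0" using n_pos a_pos by simp
  ultimately show "0 < (\<Sum>k<2 * n. chain_rate Q eps l N0 C L lam X k)"
    unfolding total_rate by linarith
  have "(\<Sum>k<n. dep X k) \<le> real n * (c0 * (1 + 1 / N0))"
    using sum_bounded_above[of "{..<n}" "dep X" "c0 * (1 + 1 / N0)"] dep_range(2) by auto
  then show "(\<Sum>k<2 * n. chain_rate Q eps l N0 C L lam X k) \<le> R"
    unfolding total_rate R_def by linarith
qed

end

section \<open>Limits of scaled paths\<close>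

context network
begin

abbreviation interference :: "(nat \<Rightarrow> real) \<Rightarrow> nat \<Rightarrow> real" where
  "interference y i \<equiv> \<Sum>j<n. y j * w i j"

text \<open>\<open>D\<close> plays the role of the integral of \<open>dep (Y t)\<close>; all that is used of the integral is that its
  increments lie between the bounds of the integrand.\<close>
definition tracks_departures :: "real \<Rightarrow> (real \<Rightarrow> nat \<Rightarrow> nat) \<Rightarrow> (nat \<Rightarrow> real \<Rightarrow> real) \<Rightarrow> bool" where
  "tracks_departures T Y D \<longleftrightarrow> (\<forall>i<n. R-lipschitz_on {0..} (D i) \<and> mono_on {0..} (D i) \<and> D i 0 = 0 \<and>
     (\<forall>s t \<alpha> \<beta>. 0 \<le> s \<longrightarrow> s \<le> t \<longrightarrow> t \<le> T \<longrightarrow> (\<forall>v\<in>{s..t}. \<alpha> \<le> dep (Y v) i \<and> dep (Y v) i \<le> \<beta>) \<longrightarrow>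
        \<alpha> * (t - s) \<le> D i t - D i s \<and> D i t - D i s \<le> \<beta> * (t - s)))"

text \<open>The interface between probability and analysis: probability only shows that most paths
  have this property, and compactness only draws consequences from it.\<close>

definition near_fluid :: "real \<Rightarrow> real \<Rightarrow> nat \<Rightarrow> (nat \<Rightarrow> nat) \<Rightarrow> (real \<Rightarrow> nat \<Rightarrow> nat) \<Rightarrow> bool" where
  "near_fluid \<theta> T z X Y \<longleftrightarrow> (\<exists>D. tracks_departures T Y D \<and>
     (\<forall>t\<in>{0..T}. \<forall>i<n. \<bar>real (Y t i) / real z - (real (X i) / real z + a * t - D i t)\<bar> \<le> \<theta>))"

text \<open>The properties of a limit \<open>x\<close> of scaled trajectories, and of the limit \<open>D\<close> of the scaled cumulative
  departures, that survive locally uniform convergence; they already determine the derivative of \<open>D\<close>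
  wherever \<open>x\<close> is positive.\<close>
definition fluid_pair :: "(nat \<Rightarrow> real) \<Rightarrow> (real \<Rightarrow> nat \<Rightarrow> real) \<Rightarrow> (nat \<Rightarrow> real \<Rightarrow> real) \<Rightarrow> bool" where
  "fluid_pair x0 x D \<longleftrightarrow> (\<forall>i<n. R-lipschitz_on {0..} (D i) \<and> mono_on {0..} (D i) \<and> D i 0 = 0 \<and>
     (\<forall>t\<ge>0. 0 \<le> x t i \<and> x t i = x0 i + a * t - D i t) \<and>
     (\<forall>s t b \<sigma>. 0 \<le> s \<longrightarrow> s \<le> t \<longrightarrow> \<sigma> > 0 \<longrightarrow>
        ((\<forall>v\<in>{s..t}. x v i \<le> b \<and> \<sigma> \<le> interference (x v) i) \<longrightarrow> D i t - D i s \<le> c0 * b / \<sigma> * (t - s)) \<and>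
        ((\<forall>v\<in>{s..t}. b \<le> x v i \<and> interference (x v) i \<le> \<sigma>) \<longrightarrow> c0 * b / \<sigma> * (t - s) \<le> D i t - D i s)))"

lemma R_pos: "0 < R"
  using jump_chain.total_pos[OF jump_chain] jump_chain.total_le[OF jump_chain] by (meson order.strict_trans2)

lemma interference_close:
  assumes "\<And>j. j < n \<Longrightarrow> \<bar>y j - y' j\<bar> \<le> \<epsilon>" "0 \<le> \<epsilon>"
  shows "\<bar>interference y i - interference y' i\<bar> \<le> real n * \<epsilon>"
proof -
  have "interference y i - interference y' i = (\<Sum>j<n. (y j - y' j) * w i j)"
    by (simp add: sum_subtractf left_diff_distrib)
  also have "\<bar>\<dots>\<bar> \<le> (\<Sum>j<n. \<bar>(y j - y' j) * w i j\<bar>)" by (rule sum_abs)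
  also have "\<dots> \<le> (\<Sum>j<n. \<epsilon>)"
  proof (rule sum_mono)
    fix j assume "j \<in> {..<n}"
    then have "\<bar>y j - y' j\<bar> * w i j \<le> \<epsilon> * 1"
      using assms weight_range by (intro mult_mono) auto
    then show "\<bar>(y j - y' j) * w i j\<bar> \<le> \<epsilon>" by (simp add: abs_mult weight_range)
  qed
  finally show ?thesis by simp
qed

text \<open>Horizon and tolerance improve together with \<open>m\<close>, so the selected paths
  converge uniformly on every bounded interval. The rate bounds do not transfer directly, since the
  rates before the limit still contain \<open>N0 / z\<close> and \<open>1 / z\<close>; they are
  relaxed by a slack \<eta>, which is removed at the end.\<close>

lemma limit_fluid_pair:
  fixes Y :: "nat \<Rightarrow> real \<Rightarrow> nat \<Rightarrow> nat" and X :: "nat \<Rightarrow> nat \<Rightarrow> nat" and z :: "nat \<Rightarrow> nat"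
  assumes near: "\<And>m. near_fluid (1 / real (Suc m)) (real m) (z m) (X m) (Y m)"
    and z: "filterlim (\<lambda>m. real (z m)) at_top sequentially"
    and X: "\<And>i. i < n \<Longrightarrow> (\<lambda>m. real (X m i) / real (z m)) \<longlonglongrightarrow> x0 i"
  obtains x D r where "fluid_pair x0 x D" "\<And>m. m \<le> r m"
    "\<And>T \<epsilon>. \<epsilon> > 0 \<Longrightarrow> \<forall>\<^sub>F m in sequentially. \<forall>t\<in>{0..T}. \<forall>i<n.
        \<bar>real (Y (r m) t i) / real (z (r m)) - x t i\<bar> \<le> \<epsilon>"
proof -
  obtain DD where DD: "\<And>m. tracks_departures (real m) (Y m) (DD m)"
    "\<And>m t i. 0 \<le> t \<Longrightarrow> t \<le> real m \<Longrightarrow> i < n \<Longrightarrow>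
      \<bar>real (Y m t i) / real (z m) - (real (X m i) / real (z m) + a * t - DD m i t)\<bar> \<le> 1 / real (Suc m)"
    using near unfolding near_fluid_def by (metis atLeastAtMost_iff)
  have lip: "\<And>m i. i < n \<Longrightarrow> R-lipschitz_on {0..} (DD m i)"
    and mono: "\<And>m i. i < n \<Longrightarrow> mono_on {0..} (DD m i)"
    and zero: "\<And>m i. i < n \<Longrightarrow> DD m i 0 = 0"
    using DD(1) unfolding tracks_departures_def by auto
  obtain D r where r: "\<And>m. m \<le> r m"
    and D: "\<And>m i t. i < n \<Longrightarrow> 0 \<le> t \<Longrightarrow> t \<le> real m \<Longrightarrow> \<bar>DD (r m) i t - D i t\<bar> \<le> 1 / real (Suc m)"
    using lipschitz_locally_uniform_limit[of "{..<n}" R DD] lip zero by (metis finite_lessThan lessThan_iff)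
  have r_lim: "filterlim r at_top sequentially"
    by (rule filterlim_at_top_mono[OF filterlim_ident]) (use r in auto)
  define x where "x t i = x0 i + a * t - D i t" for t i
  define p where "p m t i = real (Y (r m) t i) / real (z (r m))" for m t i
  have inv: "\<forall>\<^sub>F m in sequentially. 1 / real (Suc m) \<le> \<epsilon>" if "\<epsilon> > 0" for \<epsilon> :: real
  proof -
    have "(\<lambda>m. 1 / real (Suc m)) \<longlonglongrightarrow> 0" by (rule lim_1_over_n[THEN LIMSEQ_Suc])
    from order_tendstoD(2)[OF this that] show ?thesis by eventually_elim simp
  qed
  have ptw: "(\<lambda>m. DD (r m) i t) \<longlonglongrightarrow> D i t" if "i < n" "0 \<le> t" for i t
  proof (rule LIMSEQ_I)
    fix \<epsilon> :: real assume "\<epsilon> > 0"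
    then have "\<forall>\<^sub>F m in sequentially. 1 / real (Suc m) \<le> \<epsilon> / 2" by (intro inv) auto
    moreover have "\<forall>\<^sub>F m in sequentially. t \<le> real m"
      using eventually_ge_at_top[of "nat \<lceil>t\<rceil>"] by eventually_elim linarith
    ultimately have "\<forall>\<^sub>F m in sequentially. norm (DD (r m) i t - D i t) < \<epsilon>"
    proof eventually_elim
      case (elim m)
      then show ?case using D[OF that, of m] \<open>\<epsilon> > 0\<close> by simp
    qed
    then show "\<exists>N. \<forall>m\<ge>N. norm (DD (r m) i t - D i t) < \<epsilon>"
      by (simp add: eventually_sequentially)
  qed
  have unif: "\<forall>\<^sub>F m in sequentially. \<forall>t\<in>{0..T}. \<forall>i<n. \<bar>p m t i - x t i\<bar> \<le> \<epsilon>" if \<epsilon>: "\<epsilon> > 0" for T \<epsilon>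
  proof -
    have "\<forall>\<^sub>F m in sequentially. 1 / real (Suc m) \<le> \<epsilon> / 3" using \<epsilon> by (intro inv) auto
    moreover have "\<forall>\<^sub>F m in sequentially. T \<le> real m"
      using eventually_ge_at_top[of "nat \<lceil>T\<rceil>"] by eventually_elim linarith
    moreover have "\<forall>\<^sub>F m in sequentially. \<forall>i\<in>{..<n}. \<bar>real (X (r m) i) / real (z (r m)) - x0 i\<bar> < \<epsilon> / 3"
    proof (rule eventually_ball_finite)
      show "\<forall>i\<in>{..<n}. \<forall>\<^sub>F m in sequentially. \<bar>real (X (r m) i) / real (z (r m)) - x0 i\<bar> < \<epsilon> / 3"
      proof
        fix i assume "i \<in> {..<n}"
        then have "(\<lambda>m. real (X (r m) i) / real (z (r m))) \<longlonglongrightarrow> x0 i"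
          using filterlim_compose[OF X r_lim] by simp
        from tendstoD[OF this, of "\<epsilon> / 3"] \<epsilon>
        show "\<forall>\<^sub>F m in sequentially. \<bar>real (X (r m) i) / real (z (r m)) - x0 i\<bar> < \<epsilon> / 3"
          by (simp add: dist_real_def)
      qed
    qed simp
    ultimately show ?thesis
    proof eventually_elim
      case (elim m)
      show ?case
      proof (intro ballI allI impI)
        fix t i assume t: "t \<in> {0..T}" and i: "i < n"
        have tm: "0 \<le> t" "t \<le> real m" "t \<le> real (r m)" using t elim r[of m] by auto
        have "1 / real (Suc (r m)) \<le> 1 / real (Suc m)"
          using r[of m] by (intro divide_left_mono) auto
        then have "\<bar>p m t i - (real (X (r m) i) / real (z (r m)) + a * t - DD (r m) i t)\<bar> \<le> \<epsilon> / 3"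
          using DD(2)[OF tm(1,3) i] elim unfolding p_def by linarith
        moreover have "\<bar>DD (r m) i t - D i t\<bar> \<le> \<epsilon> / 3"
          using D[OF i tm(1,2)] elim by linarith
        moreover have "\<bar>real (X (r m) i) / real (z (r m)) - x0 i\<bar> < \<epsilon> / 3"
          using elim i by auto
        ultimately show "\<bar>p m t i - x t i\<bar> \<le> \<epsilon>" unfolding x_def by linarith
      qed
    qed
  qed
  have z_lim: "filterlim (\<lambda>m. real (z (r m))) at_top sequentially"
    by (rule filterlim_compose[OF z r_lim])
  \<comment> \<open>The slack absorbs the uniform error and both scaling corrections. The upper
    bound asks for \<open>\<eta> < \<sigma>\<close> to stay away from the empty state, where the
    quotient is discontinuous.\<close>
  have rates: "\<forall>\<^sub>F m in sequentially. \<forall>v\<in>{0..T}. \<forall>i<n.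
      (\<forall>b \<sigma>. x v i \<le> b \<longrightarrow> \<sigma> \<le> interference (x v) i \<longrightarrow> \<eta> < \<sigma> \<longrightarrow>
        dep (Y (r m) v) i \<le> c0 * (b + \<eta>) / (\<sigma> - \<eta>)) \<and>
      (\<forall>b \<sigma>. b \<le> x v i \<longrightarrow> interference (x v) i \<le> \<sigma> \<longrightarrow> 0 < \<sigma> \<longrightarrow>
        c0 * (b - \<eta>) / (\<sigma> + \<eta>) \<le> dep (Y (r m) v) i)"
    if \<eta>: "\<eta> > 0" for T \<eta>
  proof -
    \<comment> \<open>An error \<eta>' in each content moves the interference by at most \<eta> / 2;
      the other half of \<eta> is reserved for \<open>1 / z\<close> and
      \<open>N0 / z\<close>.\<close>
    define \<eta>' where "\<eta>' = \<eta> / (2 * real n)"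
    have \<eta>': "\<eta>' > 0" "real n * \<eta>' = \<eta> / 2" "\<eta>' \<le> \<eta>"
      using \<eta> n_pos by (auto simp: \<eta>'_def field_simps)
    have "\<forall>\<^sub>F m in sequentially. real (z (r m)) > max 1 ((1 + N0) / (\<eta> / 2))"
      using z_lim unfolding filterlim_at_top_dense by blast
    with unif[OF \<eta>'(1), of T] show ?thesis
    proof eventually_elim
      case (elim m)
      define zz where "zz = real (z (r m))"
      have zz: "zz > 0" "1 / zz + N0 / zz < \<eta> / 2"
      proof -
        show "zz > 0" using elim by (simp add: zz_def)
        then show "1 / zz + N0 / zz < \<eta> / 2"
          using elim \<eta> by (simp add: zz_def field_simps)
      qed
      then have zz': "0 \<le> 1 / zz" "1 / zz < \<eta> / 2" "0 \<le> N0 / zz" "N0 / zz < \<eta> / 2"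
        using N0_pos by (auto intro: le_less_trans[rotated])
      show ?case
      proof (intro ballI allI impI conjI)
        fix v i b \<sigma> assume v: "v \<in> {0..T}" and i: "i < n"
        have close: "\<bar>p m v i - x v i\<bar> \<le> \<eta>'" using elim v i by auto
        have p0: "0 \<le> p m v j" for j by (simp add: p_def)
        have int: "\<bar>interference (p m v) i - interference (x v) i\<bar> \<le> \<eta> / 2"
          using interference_close[of "p m v" "x v" \<eta>' i] elim v \<eta>' by auto
        note bounds = dep_scaled_bounds[OF i zz(1), of "Y (r m) v", folded zz_def, unfolded zz_def, folded p_def, folded zz_def]
        {
          assume b: "x v i \<le> b" and \<sigma>: "\<sigma> \<le> interference (x v) i" "\<eta> < \<sigma>"
          have "1 / zz < interference (p m v) i" using int \<sigma> zz' \<eta> by linarith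
          then have "dep (Y (r m) v) i \<le> c0 * p m v i / (interference (p m v) i - 1 / zz)"
            by (rule bounds(2))
          also have "\<dots> \<le> c0 * (b + \<eta>) / (\<sigma> - \<eta>)"
          proof -
            have "p m v i \<le> b + \<eta>" "\<sigma> - \<eta> \<le> interference (p m v) i - 1 / zz" "0 < \<sigma> - \<eta>"
              using close \<eta>' b \<sigma> int zz' by linarith+
            moreover from this have "0 \<le> b + \<eta>" using p0[of i] by linarith
            ultimately show ?thesis using c0_pos by (intro frac_le mult_left_mono mult_nonneg_nonneg) auto
          qed
          finally show "dep (Y (r m) v) i \<le> c0 * (b + \<eta>) / (\<sigma> - \<eta>)" .
        }
        {
          assume b: "b \<le> x v i" and \<sigma>: "interference (x v) i \<le> \<sigma>" "0 < \<sigma>"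
          have p_le: "p m v i \<le> interference (p m v) i"
            by (rule interference_ge_self[OF i]) (rule p0)
          show "c0 * (b - \<eta>) / (\<sigma> + \<eta>) \<le> dep (Y (r m) v) i"
          \<comment> \<open>A nonpositive lower bound is trivial; otherwise \<open>p m v i\<close>
            is positive, and with it the interference in the denominator.\<close>
          proof (cases "b - \<eta> \<le> 0")
            case True
            then have "c0 * (b - \<eta>) / (\<sigma> + \<eta>) \<le> 0"
              using c0_pos \<sigma> \<eta> by (intro divide_nonpos_pos mult_nonneg_nonpos) auto
            then show ?thesis using dep_range(1)[OF i] order.trans by blast
          next
            case False
            then have "0 < interference (p m v) i + N0 / zz"
              using p_le close b \<eta>' zz' by linarith
            then have "c0 * (b - \<eta>) / (\<sigma> + \<eta>) \<le> c0 * p m v i / (interference (p m v) i + N0 / zz)"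
            proof -
              have "b - \<eta> \<le> p m v i" "interference (p m v) i + N0 / zz \<le> \<sigma> + \<eta>"
                using close \<eta>' b \<sigma> int zz' by linarith+
              then show ?thesis
                using \<open>0 < interference (p m v) i + N0 / zz\<close> c0_pos p0[of i]
                by (intro frac_le mult_left_mono mult_nonneg_nonneg) auto
            qed
            also have "\<dots> \<le> dep (Y (r m) v) i" by (rule bounds(1))
            finally show ?thesis .
          qed
        }
      qed
    qed
  qed
  have tracks: "\<alpha> * (t - s) \<le> D i t - D i s \<and> D i t - D i s \<le> \<beta> * (t - s)"
    if i: "i < n" and st: "0 \<le> s" "s \<le> t"
      and ev: "\<forall>\<^sub>F m in sequentially. \<forall>v\<in>{s..t}. \<alpha> \<le> dep (Y (r m) v) i \<and> dep (Y (r m) v) i \<le> \<beta>"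
    for i s t \<alpha> \<beta>
  proof -
    have "\<forall>\<^sub>F m in sequentially. t \<le> real m"
      using eventually_ge_at_top[of "nat \<lceil>t\<rceil>"] by eventually_elim linarith
    with ev have ev': "\<forall>\<^sub>F m in sequentially. \<alpha> * (t - s) \<le> DD (r m) i t - DD (r m) i s \<and>
        DD (r m) i t - DD (r m) i s \<le> \<beta> * (t - s)"
    proof eventually_elim
      case (elim m)
      then have "t \<le> real (r m)" using r[of m] by linarith
      then show ?case
        using DD(1)[of "r m"] i st elim(1) unfolding tracks_departures_def by blast
    qed
    have lim: "(\<lambda>m. DD (r m) i t - DD (r m) i s) \<longlonglongrightarrow> D i t - D i s"
      using ptw[OF i, of t] ptw[OF i, of s] st by (intro tendsto_diff) auto
    show ?thesis
      using tendsto_lowerbound[OF lim, of "\<alpha> * (t - s)"] tendsto_upperbound[OF lim, of "\<beta> * (t - s)"] ev'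
      by (simp add: eventually_conj_iff)
  qed
  have "fluid_pair x0 x D"
    unfolding fluid_pair_def
  proof (intro allI impI conjI)
    fix i assume i: "i < n"
    show "D i 0 = 0"
      using LIMSEQ_unique[OF ptw[OF i, of 0]] zero[OF i] by simp
    show "mono_on {0..} (D i)"
    proof (rule mono_onI)
      fix s t :: real assume "s \<in> {0..}" "t \<in> {0..}" "s \<le> t"
      then show "D i s \<le> D i t"
        by (intro LIMSEQ_le[OF ptw[OF i] ptw[OF i]]) (auto intro!: exI[of _ 0] mono_onD[OF mono[OF i]])
    qed
    show "R-lipschitz_on {0..} (D i)"
    proof (rule lipschitz_onI)
      fix s t :: real assume st: "s \<in> {0..}" "t \<in> {0..}"
      have "(\<lambda>m. dist (DD (r m) i s) (DD (r m) i t)) \<longlonglongrightarrow> dist (D i s) (D i t)"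
        using st by (intro tendsto_dist ptw[OF i]) auto
      then show "dist (D i s) (D i t) \<le> R * dist s t"
        by (rule LIMSEQ_le_const2) (use lipschitz_onD[OF lip[OF i]] st in auto)
    qed (use R_pos in simp)
    show "0 \<le> x t i" if "0 \<le> t" for t
    proof (rule field_le_epsilon)
      fix \<epsilon> :: real assume "\<epsilon> > 0"
      from eventually_happens[OF unif[OF this, of t]]
      obtain m where "\<forall>t'\<in>{0..t}. \<forall>i<n. \<bar>p m t' i - x t' i\<bar> \<le> \<epsilon>"
        by auto
      then have "\<bar>p m t i - x t i\<bar> \<le> \<epsilon>" using that i by auto
      moreover have "0 \<le> p m t i" by (simp add: p_def)
      ultimately show "0 \<le> x t i + \<epsilon>" by linarith
    qed
    show "x t i = x0 i + a * t - D i t" for t by (simp add: x_def)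
    fix s t b \<sigma> :: real assume st: "0 \<le> s" "s \<le> t" and \<sigma>: "\<sigma> > 0"
    have small: "\<forall>\<^sub>F \<eta> in at_right (0::real). 0 < \<eta> \<and> \<eta> < \<sigma>"
      using \<sigma> by (auto simp: eventually_at_right_field)
    show "D i t - D i s \<le> c0 * b / \<sigma> * (t - s)"
      if h: "\<forall>v\<in>{s..t}. x v i \<le> b \<and> \<sigma> \<le> interference (x v) i"
    \<comment> \<open>The limit in \<open>m\<close> is taken for fixed \<eta>, and only then does
      \<eta> tend to 0.\<close>
    proof (rule tendsto_lowerbound)
      show "((\<lambda>\<eta>. c0 * (b + \<eta>) / (\<sigma> - \<eta>) * (t - s)) \<longlongrightarrow> c0 * b / \<sigma> * (t - s)) (at_right 0)"
        using \<sigma> by (auto intro!: tendsto_eq_intros)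
      show "\<forall>\<^sub>F \<eta> in at_right 0. D i t - D i s \<le> c0 * (b + \<eta>) / (\<sigma> - \<eta>) * (t - s)"
        using small
      proof eventually_elim
        case (elim \<eta>)
        \<comment> \<open>\<open>tracks\<close> asks for bounds on both sides; the other one is the
          trivial 0 here and the uniform bound of \<open>dep_range\<close> in the mirror
          case.\<close>
        have "\<forall>\<^sub>F m in sequentially. \<forall>v\<in>{s..t}. 0 \<le> dep (Y (r m) v) i \<and>
            dep (Y (r m) v) i \<le> c0 * (b + \<eta>) / (\<sigma> - \<eta>)"
          using rates[of \<eta> t]
          by (rule eventually_mono) (use elim h st i dep_range(1)[OF i] in auto)
        from tracks[OF i st this] show ?case by simp
      qed
    qed simp
    show "c0 * b / \<sigma> * (t - s) \<le> D i t - D i s"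
      if h: "\<forall>v\<in>{s..t}. b \<le> x v i \<and> interference (x v) i \<le> \<sigma>"
    proof (rule tendsto_upperbound)
      show "((\<lambda>\<eta>. c0 * (b - \<eta>) / (\<sigma> + \<eta>) * (t - s)) \<longlongrightarrow> c0 * b / \<sigma> * (t - s)) (at_right 0)"
        using \<sigma> by (auto intro!: tendsto_eq_intros)
      show "\<forall>\<^sub>F \<eta> in at_right 0. c0 * (b - \<eta>) / (\<sigma> + \<eta>) * (t - s) \<le> D i t - D i s"
        using small
      proof eventually_elim
        case (elim \<eta>)
        have "\<forall>\<^sub>F m in sequentially. \<forall>v\<in>{s..t}. c0 * (b - \<eta>) / (\<sigma> + \<eta>) \<le> dep (Y (r m) v) i \<and>
            dep (Y (r m) v) i \<le> c0 * (1 + 1 / N0)"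
          using rates[of \<eta> t]
          by (rule eventually_mono) (use elim h st i \<sigma> dep_range(2)[OF i] in auto)
        from tracks[OF i st this] show ?case by simp
      qed
    qed simp
  qed
  then show ?thesis
    by (rule that[OF _ r]) (use unif in \<open>simp add: p_def\<close>)
qed

end

section \<open>Limits are fluid limits\<close>

context network
begin

context
  fixes x0 x D
  assumes pair: "fluid_pair x0 x D"
begin

lemma pair_facts:
  assumes "i < n"
  shows "R-lipschitz_on {0..} (D i)" "mono_on {0..} (D i)" "D i 0 = 0"
    "0 \<le> t \<Longrightarrow> 0 \<le> x t i" "0 \<le> t \<Longrightarrow> x t i = x0 i + a * t - D i t"
    "\<lbrakk>0 \<le> s; s \<le> t; \<sigma> > 0; \<And>v. v \<in> {s..t} \<Longrightarrow> x v i \<le> b \<and> \<sigma> \<le> interference (x v) i\<rbrakk>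
      \<Longrightarrow> D i t - D i s \<le> c0 * b / \<sigma> * (t - s)"
    "\<lbrakk>0 \<le> s; s \<le> t; \<sigma> > 0; \<And>v. v \<in> {s..t} \<Longrightarrow> b \<le> x v i \<and> interference (x v) i \<le> \<sigma>\<rbrakk>
      \<Longrightarrow> c0 * b / \<sigma> * (t - s) \<le> D i t - D i s"
  using pair assms unfolding fluid_pair_def by (blast+)

lemma pair_lipschitz:
  assumes i: "i < n"
  shows "(a + R)-lipschitz_on {0..} (\<lambda>t. x t i)"
proof (rule lipschitz_onI)
  fix s t :: real assume st: "s \<in> {0..}" "t \<in> {0..}"
  have "\<bar>D i s - D i t\<bar> \<le> R * \<bar>s - t\<bar>"
    using lipschitz_onD[OF pair_facts(1)[OF i] st] by (simp add: dist_real_def)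
  moreover have "x s i - x t i = a * (s - t) - (D i s - D i t)"
    using pair_facts(5)[OF i, of s] pair_facts(5)[OF i, of t] st right_diff_distrib[of a s t] by simp
  moreover have "\<bar>a * (s - t)\<bar> = a * \<bar>s - t\<bar>" by (simp only: abs_mult[of a] abs_of_pos[OF a_pos])
  ultimately have "\<bar>x s i - x t i\<bar> \<le> a * \<bar>s - t\<bar> + R * \<bar>s - t\<bar>" by linarith
  then show "dist (x s i) (x t i) \<le> (a + R) * dist s t"
    by (simp add: dist_real_def algebra_simps)
qed (use a_pos R_pos in simp)

lemma pair_close:
  assumes "i < n" "0 \<le> s" "0 \<le> t" "\<bar>s - t\<bar> \<le> h"
  shows "\<bar>x s i - x t i\<bar> \<le> (a + R) * h"
proof -
  have "\<bar>x s i - x t i\<bar> \<le> (a + R) * \<bar>s - t\<bar>"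
    using lipschitz_onD[OF pair_lipschitz[OF assms(1)], of s t] assms by (simp add: dist_real_def)
  also have "\<dots> \<le> (a + R) * h"
    using assms a_pos R_pos by (intro mult_left_mono) auto
  finally show ?thesis .
qed

text \<open>Shortly before \<open>t\<close> the neighbour keeps the interference at \<open>i\<close>
  bounded below. If \<open>x t i\<close> were 0, the content of \<open>i\<close> would be tiny
  there, so it would depart at less than the arrival rate and the content would have grown up to
  \<open>t\<close>; hence it was negative before. Looking backwards is possible because
  \<open>t > 0\<close>.\<close>

lemma neighbour_positive:
  assumes i: "i < n" and j: "j < n" and w: "w i j = 1" and t: "t > 0" and pos: "x t j > 0"
  shows "x t i > 0"
proof (rule ccontr)
  assume "\<not> x t i > 0"
  then have 0: "x t i = 0" using pair_facts(4)[OF i, of t] t by auto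
  define c where "c = x t j / 2"
  \<comment> \<open>Chosen so that the departure bound \<open>c0 * b / c\<close> equals
    \<open>a / 2\<close>, half of the arrival rate.\<close>
  define b where "b = c * a / (2 * c0)"
  define h where "h = min t (min c b / (a + R))"
  have B: "a + R > 0" using a_pos R_pos by linarith
  have cb: "c > 0" "b > 0" using pos a_pos c0_pos by (auto simp: c_def b_def simp del: zero_less_mult_iff)
  have h: "h > 0" "h \<le> t" "(a + R) * h \<le> c" "(a + R) * h \<le> b"
  proof -
    show "h > 0" "h \<le> t" using t cb B by (auto simp: h_def)
    have "(a + R) * h \<le> (a + R) * (min c b / (a + R))"
      using B by (intro mult_left_mono) (auto simp: h_def)
    also have "\<dots> = min c b" using B by simp
    finally show "(a + R) * h \<le> c" "(a + R) * h \<le> b" by auto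
  qed
  have "D i t - D i (t - h) \<le> c0 * b / c * (t - (t - h))"
  proof (rule pair_facts(6)[OF i])
    fix v assume v: "v \<in> {t - h..t}"
    then have v0: "0 \<le> v" "\<bar>v - t\<bar> \<le> h" using h by auto
    have "\<bar>x v i - x t i\<bar> \<le> (a + R) * h" "\<bar>x v j - x t j\<bar> \<le> (a + R) * h"
      using pair_close[OF i, of v t h] pair_close[OF j, of v t h] v0 t by auto
    then have "x v i \<le> b" "c \<le> x v j" using 0 h unfolding c_def by linarith+
    moreover have "x v j * w i j \<le> interference (x v) i"
      using j pair_facts(4) v0 weight_range
      by (intro member_le_sum[of j "{..<n}" "\<lambda>j. x v j * w i j"]) auto
    ultimately show "x v i \<le> b \<and> c \<le> interference (x v) i" using w by simp
  qed (use h cb in auto)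
  also have "\<dots> = a * h / 2"
    using cb c0_pos by (simp add: b_def)
  finally have "D i t - D i (t - h) \<le> a * h / 2" .
  moreover have "x t i - x (t - h) i = a * h - (D i t - D i (t - h))"
    using pair_facts(5)[OF i, of t] pair_facts(5)[OF i, of "t - h"] h t right_diff_distrib[of a t h] by simp
  moreover have "0 \<le> x (t - h) i" using pair_facts(4)[OF i] h by simp
  moreover have "a * h > 0" using a_pos h by simp
  ultimately show False using 0 by linarith
qed

lemma all_positive:
  assumes j: "j < n" and i: "i < n" and t: "t > 0" and pos: "x t j > 0"
  shows "x t i > 0"
proof (rule grid_connected[of j "side Q eps" "\<lambda>i. x t i > 0"])
  fix i i' assume "i < (side Q eps)\<^sup>2" "i' < (side Q eps)\<^sup>2" "0 < x t i"
    "\<bar>real (i mod side Q eps) - real (i' mod side Q eps)\<bar> \<le> 1"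
    "\<bar>real (i div side Q eps) - real (i' div side Q eps)\<bar> \<le> 1"
  then show "0 < x t i'"
    using neighbour_positive[of i' i t] weight_adjacent[of i' i] t
    by (simp add: ncells_def abs_minus_commute)
qed (use j i pos in \<open>auto simp: ncells_def\<close>)

text \<open>Content and interference vary little near \<open>t\<close>, so difference quotients of
  \<open>D i\<close> are squeezed between two perturbed quotients within \<open>e\<close> of the
  claimed value. Positivity of \<open>x t i\<close> keeps the denominators away from 0.\<close>

lemma departure_derivative:
  assumes i: "i < n" and t: "t > 0" and pos: "x t i > 0"
  shows "(D i has_real_derivative c0 * x t i / interference (x t) i) (at t)"
proof (rule has_real_derivative_sandwich)
  fix e :: real assume e: "e > 0"
  define y where "y = x t i"
  define \<sigma> where "\<sigma> = interference (x t) i"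
  define \<phi> where "\<phi> = c0 * y / \<sigma>"
  have \<sigma>: "\<sigma> > 0"
    using interference_ge_self[OF i, of "x t"] pair_facts(4) t pos by (force simp: \<sigma>_def)
  have B: "a + R > 0" using a_pos R_pos by linarith
  have up: "((\<lambda>\<eta>. c0 * (y + \<eta>) / (\<sigma> - \<eta>)) \<longlongrightarrow> \<phi>) (at_right 0)"
    and low: "((\<lambda>\<eta>. c0 * (y - \<eta>) / (\<sigma> + \<eta>)) \<longlongrightarrow> \<phi>) (at_right 0)"
    unfolding \<phi>_def using \<sigma> by (auto intro!: tendsto_eq_intros)
  have "\<forall>\<^sub>F \<eta> in at_right 0. c0 * (y + \<eta>) / (\<sigma> - \<eta>) < \<phi> + e \<and> \<phi> - e < c0 * (y - \<eta>) / (\<sigma> + \<eta>)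
      \<and> 0 < \<eta> \<and> \<eta> < \<sigma>"
  proof (intro eventually_conj)
    show "\<forall>\<^sub>F \<eta> in at_right 0. 0 < (\<eta>::real)"
      by (rule eventually_at_right_less)
    show "\<forall>\<^sub>F \<eta> in at_right 0. \<eta> < \<sigma>"
      using \<sigma> by (auto simp: eventually_at_right_field)
  qed (use order_tendstoD(2)[OF up, of "\<phi> + e"] order_tendstoD(1)[OF low, of "\<phi> - e"] e in auto)
  then obtain \<eta> where \<eta>: "c0 * (y + \<eta>) / (\<sigma> - \<eta>) < \<phi> + e" "\<phi> - e < c0 * (y - \<eta>) / (\<sigma> + \<eta>)"
    "0 < \<eta>" "\<eta> < \<sigma>"
    using eventually_happens'[OF trivial_limit_at_right_real] by blast
  \<comment> \<open>Over a time \<open>d\<close> a content changes by at most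
    \<open>(a + R) * d\<close>, and the interference by at most \<open>n\<close> times this. The
    minimum with \<open>t\<close> avoids negative times.\<close>
  define d where "d = min t (\<eta> / ((a + R) * real n))"
  have d: "d > 0" "d \<le> t" "real n * ((a + R) * d) \<le> \<eta>" "(a + R) * d \<le> \<eta>"
  proof -
    show d0: "d > 0" "d \<le> t" using t \<eta> B n_pos by (auto simp: d_def)
    have "((a + R) * real n) * d \<le> ((a + R) * real n) * (\<eta> / ((a + R) * real n))"
      using B n_pos by (intro mult_left_mono) (auto simp: d_def)
    also have "\<dots> = \<eta>" using B n_pos by simp
    finally show nd: "real n * ((a + R) * d) \<le> \<eta>" by (simp add: mult_ac)
    have "1 * ((a + R) * d) \<le> real n * ((a + R) * d)"
      using B d0 n_pos by (intro mult_right_mono) auto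
    then show "(a + R) * d \<le> \<eta>" using nd by simp
  qed
  have near: "\<bar>x v i - y\<bar> \<le> \<eta> \<and> \<bar>interference (x v) i - \<sigma>\<bar> \<le> \<eta>" if "\<bar>v - t\<bar> \<le> d" for v
  proof -
    have "\<bar>x v j - x t j\<bar> \<le> (a + R) * d" if "j < n" for j
      using pair_close[OF that, of v t d] \<open>\<bar>v - t\<bar> \<le> d\<close> d t by auto
    then show ?thesis
      using interference_close[of "x v" "x t" "(a + R) * d" i] i d B unfolding y_def \<sigma>_def by force
  qed
  have incr: "\<bar>D i q - D i p - \<phi> * (q - p)\<bar> \<le> e * (q - p)"
    if pq: "p \<le> q" "t - d \<le> p" "q \<le> t + d" for p q
  proof -
    have "D i q - D i p \<le> c0 * (y + \<eta>) / (\<sigma> - \<eta>) * (q - p)"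
    proof (rule pair_facts(6)[OF i])
      fix v assume "v \<in> {p..q}"
      then show "x v i \<le> y + \<eta> \<and> \<sigma> - \<eta> \<le> interference (x v) i"
        using near[of v] pq by (auto simp: abs_le_iff)
    qed (use pq d \<eta> in auto)
    also have "\<dots> \<le> (\<phi> + e) * (q - p)" using \<eta> pq by (intro mult_right_mono) auto
    finally have 1: "D i q - D i p \<le> (\<phi> + e) * (q - p)" .
    have "(\<phi> - e) * (q - p) \<le> c0 * (y - \<eta>) / (\<sigma> + \<eta>) * (q - p)"
      using \<eta> pq by (intro mult_right_mono) auto
    also have "\<dots> \<le> D i q - D i p"
    proof (rule pair_facts(7)[OF i])
      fix v assume "v \<in> {p..q}"
      then show "y - \<eta> \<le> x v i \<and> interference (x v) i \<le> \<sigma> + \<eta>"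
        using near[of v] pq by (auto simp: abs_le_iff)
    qed (use pq d \<eta> in auto)
    finally show ?thesis using 1 by (simp add: abs_le_iff algebra_simps)
  qed
  have "\<bar>D i v - D i t - \<phi> * (v - t)\<bar> \<le> e * \<bar>v - t\<bar>" if v: "\<bar>v - t\<bar> < d" for v
  proof (cases "t \<le> v")
    case True
    then show ?thesis using incr[of t v] v d by simp
  next
    case False
    have "\<bar>D i t - D i v - \<phi> * (t - v)\<bar> \<le> e * (t - v)"
      using incr[of v t] v d False by simp
    moreover have "D i v - D i t - \<phi> * (v - t) = - (D i t - D i v - \<phi> * (t - v))"
      by (simp add: algebra_simps)
    ultimately show ?thesis using False by (simp only: abs_minus_cancel) simp
  qed
  then show "\<exists>d>0. \<forall>v. \<bar>v - t\<bar> < d \<longrightarrow>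
      \<bar>D i v - D i t - c0 * x t i / interference (x t) i * (v - t)\<bar> \<le> e * \<bar>v - t\<bar>"
    using d(1) unfolding \<phi>_def y_def \<sigma>_def by blast
qed

lemma fluid_pair_in_fluid_limits: "x \<in> fluid_limits Q eps l C L lam x0"
proof -
  define Z where "Z = {t. 0 \<le> t \<and> (\<forall>i<n. x t i = 0)}"
  have "Z = {0..} \<inter> (\<Inter>i<n. {t \<in> {0..}. x t i = 0})"
    by (auto simp: Z_def)
  moreover have "closed {t \<in> {0..}. x t i = 0}" if "i < n" for i
    using lipschitz_on_continuous_on[OF pair_lipschitz[OF that]]
    by (intro continuous_closed_preimage_constant) auto
  ultimately have "closed Z" by (auto intro!: closed_INT)
  then have Z: "Z \<in> sets borel" by simp
  have "AE t in lborel. \<forall>i\<in>{..<n}. t > 0 \<and> t \<in> Z \<longrightarrow> ((\<lambda>t. x t i) has_real_derivative 0) (at t)"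
  proof (rule AE_finite_allI)
    show "AE t in lborel. t > 0 \<and> t \<in> Z \<longrightarrow> ((\<lambda>t. x t i) has_real_derivative 0) (at t)"
      if "i \<in> {..<n}" for i
      by (rule AE_lipschitz_derivative_on_zeros[OF Z _ pair_lipschitz[of i]])
        (use that in \<open>auto simp: Z_def\<close>)
  qed simp
  \<comment> \<open>Initially some cells may be empty and others not, so \<open>all_positive\<close>
    starts only after time 0. From then on the branch \<open>x t i = 0\<close> of the derivative is
    never taken while some cell is positive.\<close>
  moreover have "AE t in lborel. t \<noteq> (0::real)" by (rule AE_lborel_singleton)
  ultimately have AE: "AE t in lborel. t \<ge> 0 \<longrightarrow>
      ((\<exists>i<n. x t i > 0) \<longrightarrow> (\<forall>i<n. (D i has_real_derivative
        (if x t i = 0 then 0 else C * x t i / (L * ln 2 * (\<Sum>k<n. x t k * w i k)))) (at t))) \<and>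
      ((\<forall>i<n. x t i = 0) \<longrightarrow> (\<forall>i<n. ((\<lambda>\<tau>. x \<tau> i) has_real_derivative 0) (at t)))"
  proof eventually_elim
    case (elim t)
    show ?case
    proof (intro impI conjI allI)
      assume t0: "0 \<le> t"
      then have t: "t > 0" using elim(2) by simp
      {
        fix i assume "\<exists>j<n. x t j > 0" and i: "i < n"
        then have p: "x t i > 0" using all_positive t by blast
        then show "(D i has_real_derivative
          (if x t i = 0 then 0 else C * x t i / (L * ln 2 * (\<Sum>k<n. x t k * w i k)))) (at t)"
          using departure_derivative[OF i t p] by (simp add: c0_def)
      }
      show "((\<lambda>\<tau>. x \<tau> i) has_real_derivative 0) (at t)" if "\<forall>i<n. x t i = 0" "i < n" for i
        using elim(1) that t by (auto simp: Z_def)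
    qed
  qed
  have D: "\<forall>i<n. mono_on {0..} (D i) \<and> D i 0 = 0 \<and> (\<exists>K. K-lipschitz_on {0..} (D i)) \<and>
      (\<forall>t\<ge>0. x t i = x 0 i + a * t - D i t)"
    using pair_facts(1-3) pair_facts(5)[of _ 0] pair_facts(5) by auto
  show ?thesis
    unfolding fluid_limits_def mem_Collect_eq
  proof (intro conjI)
    show "\<forall>i<n. x 0 i = x0 i" using pair_facts(3) pair_facts(5)[of _ 0] by simp
    show "\<forall>t\<ge>0. \<forall>i<n. 0 \<le> x t i" using pair_facts(4) by blast
  qed (use D AE in blast)
qed

end

end

section \<open>Convergence in probability\<close>

context network
begin

text \<open>The constants are uniform over all functions \<open>Y\<close>, so the lemma can be
  applied outcome by outcome to a random path. A single index \<open>N\<close> supplies tolerance,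
  horizon and threshold, which makes the negation a sequence that fits
  \<open>limit_fluid_pair\<close>.\<close>

lemma near_fluid_close:
  fixes X0 :: "nat \<Rightarrow> nat \<Rightarrow> nat" and z :: "nat \<Rightarrow> nat"
  assumes z: "filterlim (\<lambda>k. real (z k)) at_top sequentially"
    and X0: "\<And>i. i < n \<Longrightarrow> (\<lambda>k. real (X0 k i) / real (z k)) \<longlonglongrightarrow> x0 i"
    and \<delta>: "\<delta> > 0"
  obtains \<theta> T k0 where "\<theta> > 0" "\<And>k Y. k \<ge> k0 \<Longrightarrow> near_fluid \<theta> T (z k) (X0 k) Y \<Longrightarrow>
    \<exists>f\<in>fluid_limits Q eps l C L lam x0. \<forall>t\<in>{0..s}. \<forall>i<n. \<bar>real (Y t i) / real (z k) - f t i\<bar> \<le> \<delta>"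
proof -
  let ?close = "\<lambda>k Y. \<exists>f\<in>fluid_limits Q eps l C L lam x0.
    \<forall>t\<in>{0..s}. \<forall>i<n. \<bar>real (Y t i) / real (z k) - f t i\<bar> \<le> \<delta>"
  have "\<exists>N. \<forall>k\<ge>N. \<forall>Y. near_fluid (1 / real (Suc N)) (real N) (z k) (X0 k) Y \<longrightarrow> ?close k Y"
  proof (rule ccontr)
    assume "\<not> ?thesis"
    then have "\<forall>N. \<exists>k Y. N \<le> k \<and> near_fluid (1 / real (Suc N)) (real N) (z k) (X0 k) Y \<and> \<not> ?close k Y"
      by meson
    from choice[OF this] obtain k where
      "\<forall>N. \<exists>Y. N \<le> k N \<and> near_fluid (1 / real (Suc N)) (real N) (z (k N)) (X0 (k N)) Y \<and> \<not> ?close (k N) Y"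
      by blast
    from choice[OF this] obtain Y where
      kY: "\<forall>N. N \<le> k N \<and> near_fluid (1 / real (Suc N)) (real N) (z (k N)) (X0 (k N)) (Y N) \<and> \<not> ?close (k N) (Y N)"
      by blast
    have k: "\<And>N. N \<le> k N"
      and Y: "\<And>N. near_fluid (1 / real (Suc N)) (real N) (z (k N)) (X0 (k N)) (Y N)"
      and not_close: "\<And>N. \<not> ?close (k N) (Y N)"
      using kY by blast+
    have k_lim: "filterlim k at_top sequentially"
      by (rule filterlim_at_top_mono[OF filterlim_ident]) (use k in auto)
    have lims: "filterlim (\<lambda>N. real (z (k N))) at_top sequentially"
      "\<And>i. i < n \<Longrightarrow> (\<lambda>N. real (X0 (k N) i) / real (z (k N))) \<longlonglongrightarrow> x0 i"
      using filterlim_compose[OF z k_lim] filterlim_compose[OF X0 k_lim] by auto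
    obtain x D r where x: "fluid_pair x0 x D"
      and r: "\<And>T \<epsilon>. \<epsilon> > 0 \<Longrightarrow> \<forall>\<^sub>F m in sequentially. \<forall>t\<in>{0..T}. \<forall>i<n.
        \<bar>real (Y (r m) t i) / real (z (k (r m))) - x t i\<bar> \<le> \<epsilon>"
      by (rule limit_fluid_pair[of "\<lambda>N. z (k N)" "\<lambda>N. X0 (k N)" Y x0, OF Y lims]) blast+
    from eventually_happens[OF r[OF \<delta>, of s]] obtain m where
      "\<forall>t\<in>{0..s}. \<forall>i<n. \<bar>real (Y (r m) t i) / real (z (k (r m))) - x t i\<bar> \<le> \<delta>"
      by auto
    then show False
      using not_close[of "r m"] fluid_pair_in_fluid_limits[OF x] by blast
  qed
  then obtain N where "\<And>k Y. k \<ge> N \<Longrightarrow> near_fluid (1 / real (Suc N)) (real N) (z k) (X0 k) Y \<Longrightarrow> ?close k Y"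
    by blast
  moreover have "0 < 1 / real (Suc N)" by (intro divide_pos_pos) simp_all
  ultimately show ?thesis by (rule that[rotated])
qed

abbreviation chain_path :: "(nat \<Rightarrow> nat) \<Rightarrow> (nat \<Rightarrow> real) \<Rightarrow> (nat \<Rightarrow> real) \<Rightarrow> real \<Rightarrow> nat \<Rightarrow> nat" where
  "chain_path \<equiv> chainX Q eps l N0 C L lam"

text \<open>A cell collects the errors of one arrival count and one departure count, each at most
  \<open>h + c + 1\<close>; hence the factor 2.\<close>

lemma near_fluid_chain_path:
  fixes G h z :: nat and c T \<theta> :: real
  assumes noise: "\<And>m. 0 \<le> e m \<and> 0 \<le> u m \<and> u m < 1"
    and h: "h > 0" and z: "z > 0"
    and grid: "\<And>j g. j < 2 * n \<Longrightarrow> g \<le> G \<Longrightarrow>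
      \<bar>jump_chain.mart (2 * n) (chain_rate Q eps l N0 C L lam) (chain_move Q eps) X j u e (g * h)\<bar> < c"
    and long: "R * (real z * T) < real (G * h) - real (2 * n) * c"
    and small: "2 * (real h + c + 1) / real z \<le> \<theta>"
  shows "near_fluid \<theta> T z X (\<lambda>t. chain_path X u e (real z * t))"
proof -
  let ?r = "chain_rate Q eps l N0 C L lam"
  interpret jump_path "2 * n" ?r "chain_move Q eps" R X u e
    unfolding jump_path_def jump_path_axioms_def using jump_chain noise by auto
  have z': "real z > 0" using z by simp
  have path: "chain_path X u e = path" by (simp add: chainX_def fun_eq_iff)
  define N where "N = G * h"
  have track: "R * (real z * T) < real N - real (2 * n) * c" unfolding N_def by (rule long)
  note tracked = path_tracks_integrated_rates[of h G c "real z * T", OF h less_imp_le[OF grid], folded N_def, OF _ _ track]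
  have T: "real z * T < time N" by (rule tracked)
  have state_count: "real (state u m i) = real (X i) + count i u m - count (n + i) u m" if i: "i < n" for m i
  proof (induction m)
    case 0
    then show ?case by (simp add: count_def)
  next
    case (Suc m)
    define k where "k = pick (2 * n) ?r (state u m) (u m)"
    have k: "0 < ?r (state u m) k" "k < 2 * n"
      unfolding k_def using noise by (auto intro!: rate_pick_pos pick_eq_iff(1))
    \<comment> \<open>\<open>chain_move\<close> subtracts natural numbers, so the balance would fail
      at an empty cell; but such a cell has departure rate 0 and is not picked.\<close>
    have "k = n + i \<Longrightarrow> 0 < state u m i"
      using k(1) dep_zero[of "state u m" i] chain_rate_departure[of "state u m" i] by (cases "state u m i") auto
    then have "real (chain_move Q eps (state u m) k i) = real (state u m i) + of_bool (k = i) - of_bool (k = n + i)"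
      using i k(2) by (auto simp: chain_move_def of_nat_diff)
    then show ?case using Suc by (simp add: count_def k_def)
  qed
  \<comment> \<open>Time and value are scaled by the same factor, so the Lipschitz constant stays
    \<open>R\<close>.\<close>
  define D where "D i t = integrated_rate N (n + i) (real z * t) / real z" for i t
  have "tracks_departures T (\<lambda>t. chain_path X u e (real z * t)) D"
    unfolding tracks_departures_def
  proof (intro allI impI)
    fix i assume i: "i < n"
    then have j: "n + i < 2 * n" by simp
    have 1: "R-lipschitz_on {0..} (D i)"
    proof (rule lipschitz_onI)
      fix s t :: real assume "s \<in> {0..}" "t \<in> {0..}"
      then have "dist (integrated_rate N (n + i) (real z * s)) (integrated_rate N (n + i) (real z * t))
          \<le> R * dist (real z * s) (real z * t)"
        by (intro lipschitz_onD[OF integrated_rate_lipschitz[OF j]]) auto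
      also have "\<dots> = real z * (R * dist s t)"
        by (simp add: dist_real_def abs_mult flip: right_diff_distrib)
      finally show "dist (D i s) (D i t) \<le> R * dist s t"
        using z' by (simp add: D_def dist_real_def field_simps flip: diff_divide_distrib)
    qed (use R_pos in simp)
    have 2: "mono_on {0..} (D i)"
      unfolding D_def using z' by (intro mono_onI divide_right_mono integrated_rate_mono[OF j]) auto
    have 3: "\<alpha> * (t - s) \<le> D i t - D i s \<and> D i t - D i s \<le> \<beta> * (t - s)"
      if st: "0 \<le> s" "s \<le> t" "t \<le> T"
        and b: "\<forall>v\<in>{s..t}. \<alpha> \<le> dep (chain_path X u e (real z * v)) i \<and> dep (chain_path X u e (real z * v)) i \<le> \<beta>"
      for s t \<alpha> \<beta>
    proof -
      have rb: "\<alpha> \<le> ?r (path v) (n + i) \<and> ?r (path v) (n + i) \<le> \<beta>"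
        if "real z * s \<le> v" "v \<le> real z * t" for v
      proof -
        have "v / real z \<in> {s..t}" using that z' by (simp add: field_simps)
        from bspec[OF b this] show ?thesis using z' by (simp add: chain_rate_departure path)
      qed
      have zt: "real z * t \<le> real z * T" using st z' by (intro mult_left_mono) auto
      have "0 \<le> real z * s" "real z * s \<le> real z * t"
        using st z' by (auto intro: mult_left_mono)
      moreover have "real z * t \<le> time N" using zt T by linarith
      ultimately have "0 \<le> real z * s" "real z * s \<le> real z * t" "real z * t \<le> time N" .
      from integrated_rate_between[OF this rb]
      have "\<alpha> * (real z * t - real z * s) / real z \<le> D i t - D i s"
        "D i t - D i s \<le> \<beta> * (real z * t - real z * s) / real z"
        using z' unfolding D_def by (auto simp: diff_divide_distrib[symmetric] intro: divide_right_mono)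
      moreover have "\<gamma> * (real z * t - real z * s) / real z = \<gamma> * (t - s)" for \<gamma>
        using z' by (simp add: field_simps)
      ultimately show ?thesis by simp
    qed
    show "R-lipschitz_on {0..} (D i) \<and> mono_on {0..} (D i) \<and> D i 0 = 0 \<and>
     (\<forall>s t \<alpha> \<beta>. 0 \<le> s \<longrightarrow> s \<le> t \<longrightarrow> t \<le> T \<longrightarrow>
        (\<forall>v\<in>{s..t}. \<alpha> \<le> dep (chain_path X u e (real z * v)) i \<and> dep (chain_path X u e (real z * v)) i \<le> \<beta>) \<longrightarrow>
        \<alpha> * (t - s) \<le> D i t - D i s \<and> D i t - D i s \<le> \<beta> * (t - s))"
      using 1 2 3 by (auto simp: D_def integrated_rate_0)
  qed
  moreover have "\<bar>real (chain_path X u e (real z * t) i) / real z - (real (X i) / real z + a * t - D i t)\<bar> \<le> \<theta>"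
    if t: "t \<in> {0..T}" and i: "i < n" for t i
  proof -
    have zt: "0 \<le> real z * t" "real z * t \<le> real z * T"
      using t z' by (auto intro: mult_left_mono)
    obtain m where m: "path (real z * t) = state u m"
      and err: "\<And>j. j < 2 * n \<Longrightarrow> \<bar>count j u m - integrated_rate N j (real z * t)\<bar> \<le> real h + c + 1"
      using tracked(2)[OF _ _ zt] by blast
    have jumps: "real (chain_path X u e (real z * t) i) = real (X i) + count i u m - count (n + i) u m"
      by (simp only: path m state_count[OF i])
    have "real z * t \<le> time N" using zt T by linarith
    \<comment> \<open>Arrival rates are constant: equal lower and upper bounds give the integral
      exactly.\<close>
    from integrated_rate_between[OF order.refl zt(1) this, of a i a]
    have arr: "integrated_rate N i (real z * t) = a * (real z * t)"
      using i by (simp add: chain_rate_arrival integrated_rate_0)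
    have "\<bar>count i u m - a * (real z * t)\<bar> \<le> real h + c + 1"
      using err[of i] i arr by simp
    moreover have "\<bar>count (n + i) u m - integrated_rate N (n + i) (real z * t)\<bar> \<le> real h + c + 1"
      using err[of "n + i"] i by simp
    ultimately have "\<bar>(count i u m - a * (real z * t)) - (count (n + i) u m - integrated_rate N (n + i) (real z * t))\<bar> / real z
      \<le> 2 * (real h + c + 1) / real z"
      using z' by (intro divide_right_mono) auto
    moreover have "real (chain_path X u e (real z * t) i) / real z - (real (X i) / real z + a * t - D i t)
      = ((count i u m - a * (real z * t)) - (count (n + i) u m - integrated_rate N (n + i) (real z * t))) / real z"
      using z' unfolding jumps D_def by (simp add: field_simps)
    ultimately show ?thesis using small z' by simp
  qed
  ultimately show ?thesis unfolding near_fluid_def by blast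
qed

text \<open>Chebyshev wins one power of \<open>z\<close>: the number \<open>G * h\<close> of jumps,
  and so the variance, is of order \<open>z\<close>, the squared deviation of order
  \<open>z * z\<close>, and the number of grid points is fixed.\<close>

lemma chain_near_fluid_with_high_probability:
  fixes M :: "'a measure" and E U :: "nat \<Rightarrow> 'a \<Rightarrow> real"
  assumes M: "prob_space M"
    and indep: "prob_space.indep_vars M (\<lambda>_. borel)
           (\<lambda>v. case v of Inl m \<Rightarrow> E m | Inr m \<Rightarrow> U m) (UNIV :: (nat + nat) set)"
    and E: "\<And>m. distributed M lborel (E m) (\<lambda>x. ennreal (exponential_density 1 x))"
    and U: "\<And>m. distributed M lborel (U m) (\<lambda>x. ennreal (indicator {0..1} x))"
    and \<theta>: "\<theta> > 0" and \<eta>: "\<eta> > 0"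
  shows "\<exists>z0. \<forall>z X. real z \<ge> z0 \<longrightarrow> (\<exists>A\<in>sets M. measure M A < \<eta> \<and> (\<forall>\<omega>\<in>space M - A.
    near_fluid \<theta> T z X (\<lambda>t. chain_path X (\<lambda>m. U m \<omega>) (\<lambda>m. E m \<omega>) (real z * t))))"
proof -
  \<comment> \<open>\<open>G\<close> blocks of \<open>h\<close> jumps cover the time span \<open>z * T\<close>, and neither \<open>G\<close> nor \<open>B\<close> depends on \<open>z\<close>.\<close>
  define \<kappa> where "\<kappa> = \<theta> / 8"
  define G where "G = nat \<lceil>(R * T + real (2 * n) * \<kappa>) / \<kappa>\<rceil> + 1"
  define B where "B = real (2 * n) * real (Suc G) * (12 * real G)"
  \<comment> \<open>\<open>1 / \<kappa>\<close> gives \<open>c \<ge> 1\<close> and so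
    \<open>h \<le> 2 * c\<close>; the term with \<open>B\<close> makes the failure bound
    \<open>B / c\<close> smaller than \<eta>; \<open>8 / \<theta>\<close> makes the rounding error
    \<open>4 / z\<close> at most \<theta> / 2, while \<open>4 * c / z\<close> is the other
    half.\<close>
  define z0 where "z0 = max (max 1 (8 / \<theta>)) (max (1 / \<kappa>) (B / (\<kappa> * \<eta>) + 1))"
  have \<kappa>: "\<kappa> > 0" using \<theta> by (simp add: \<kappa>_def)
  have "\<exists>A\<in>sets M. measure M A < \<eta> \<and> (\<forall>\<omega>\<in>space M - A.
      near_fluid \<theta> T z X (\<lambda>t. chain_path X (\<lambda>m. U m \<omega>) (\<lambda>m. E m \<omega>) (real z * t)))"
    if z: "real z \<ge> z0" for z X
  proof -
    have z1: "real z \<ge> 1" "8 / \<theta> \<le> real z" "1 / \<kappa> \<le> real z" "B / (\<kappa> * \<eta>) < real z"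
      using z by (auto simp: z0_def)
    define c where "c = \<kappa> * real z"
    define h where "h = nat \<lceil>c\<rceil>"
    have c: "c \<ge> 1" using z1 \<kappa> by (simp add: c_def field_simps)
    then have h: "c \<le> real h" "real h \<le> c + 1" "h > 0" by (auto simp: h_def)
    interpret driven_jump_chain "2 * n" "chain_rate Q eps l N0 C L lam" "chain_move Q eps" R X M E U
      unfolding driven_jump_chain_def driven_jump_chain_axioms_def using jump_chain M indep E U by auto
    obtain A where A: "A \<in> sets M" "prob A \<le> real (2 * n) * real (Suc G) * (6 * real (G * h) / c\<^sup>2)"
      "\<And>\<omega> m. \<omega> \<in> space M - A \<Longrightarrow> 0 \<le> E m \<omega> \<and> 0 \<le> U m \<omega> \<and> U m \<omega> < 1"
      "\<And>\<omega> j g. \<omega> \<in> space M - A \<Longrightarrow> j < 2 * n \<Longrightarrow> g \<le> G \<Longrightarrow> \<bar>mart j (\<lambda>l. U l \<omega>) (\<lambda>l. E l \<omega>) (g * h)\<bar> < c"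
      by (rule bad_grid_event[of c G h]) (use c in linarith, rule that)
    have "6 * real (G * h) / c\<^sup>2 \<le> 6 * (real G * (2 * c)) / c\<^sup>2"
    proof -
      have "real G * real h \<le> real G * (2 * c)" using h c by (intro mult_left_mono) auto
      then show ?thesis by (intro divide_right_mono mult_left_mono) simp_all
    qed
    also have "\<dots> = 12 * real G / c" using c by (simp add: power2_eq_square)
    finally have "real (2 * n) * real (Suc G) * (6 * real (G * h) / c\<^sup>2) \<le> real (2 * n) * real (Suc G) * (12 * real G / c)"
      by (intro mult_left_mono) auto
    also have "\<dots> = B / c" by (simp add: B_def)
    also have "\<dots> < \<eta>"
      using z1(1,4) \<kappa> \<eta> by (simp add: c_def field_simps)
    finally have "prob A < \<eta>" using A(2) by linarith
    moreover have "near_fluid \<theta> T z X (\<lambda>t. chain_path X (\<lambda>m. U m \<omega>) (\<lambda>m. E m \<omega>) (real z * t))"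
      if \<omega>: "\<omega> \<in> space M - A" for \<omega>
    proof (rule near_fluid_chain_path[OF A(3)[OF \<omega>] h(3) _ A(4)[OF \<omega>]])
      show "0 < z" using z1 by simp
      have "(R * T + real (2 * n) * \<kappa>) / \<kappa> < real G" unfolding G_def by linarith
      then have "R * T + real (2 * n) * \<kappa> < real G * \<kappa>" using \<kappa> by (simp add: field_simps)
      then have "(R * T + real (2 * n) * \<kappa>) * real z < real G * \<kappa> * real z"
        using z1 by (intro mult_strict_right_mono) auto
      also have "\<dots> = real G * c" by (simp add: c_def)
      also have "\<dots> \<le> real (G * h)" using h(1) by (simp add: mult_left_mono)
      finally show "R * (real z * T) < real (G * h) - real (2 * n) * c"
        by (simp add: c_def algebra_simps)
      have "2 * (real h + c + 1) / real z \<le> (4 * c + 4) / real z"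
        using h z1 by (intro divide_right_mono) auto
      also have "\<dots> = \<theta> / 2 + 4 / real z"
        using z1 by (simp add: c_def \<kappa>_def add_divide_distrib)
      also have "\<dots> \<le> \<theta>" using z1 \<theta> by (simp add: field_simps)
      finally show "2 * (real h + c + 1) / real z \<le> \<theta>" .
    qed
    ultimately show ?thesis using A(1) by blast
  qed
  then show ?thesis by blast
qed

end

text \<open>The event contains an infimum over a set of functions, and its measurability is not
  claimed. Convergence in probability is expressed by measurable supersets of arbitrarily small
  measure.\<close>

theorem mainTheorem10:
  fixes Q eps N0 C L lam :: real
    and l :: "real \<Rightarrow> real"
    and M :: "'a measure"
    and E U :: "nat \<Rightarrow> 'a \<Rightarrow> real"
    and X0 :: "nat \<Rightarrow> nat \<Rightarrow> nat"
    and z :: "nat \<Rightarrow> nat"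
    and x0 :: "nat \<Rightarrow> real"
  assumes "Q > 0" and "admissible Q eps"
    and "N0 > 0" and "C > 0" and "L > 0" and "lam > 0"
    and "l 0 = 1"
    and "\<forall>r\<ge>0. l r \<ge> 0"
    and "\<exists>B. \<forall>r\<ge>0. l r \<le> B"
    and "\<forall>r r'. 0 \<le> r \<longrightarrow> r \<le> r' \<longrightarrow> l r' \<le> l r"
    and "prob_space M"
    and "prob_space.indep_vars M (\<lambda>_. borel)
           (\<lambda>v. case v of Inl m \<Rightarrow> E m | Inr m \<Rightarrow> U m) (UNIV :: (nat + nat) set)"
    and "\<forall>m. distributed M lborel (E m) (\<lambda>x. ennreal (exponential_density 1 x))"
    and "\<forall>m. distributed M lborel (U m) (\<lambda>x. ennreal (indicator {0..1} x))"
    and "\<forall>k. z k > 0"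
    and "filterlim (\<lambda>k. real (z k)) at_top sequentially"
    and "\<forall>i<ncells Q eps. (\<lambda>k. real (X0 k i) / real (z k)) \<longlonglongrightarrow> x0 i"
  shows "fluid_limits Q eps l C L lam x0 \<noteq> {} \<and>
    (\<forall>s>0. \<forall>\<delta>>0. \<forall>\<eta>>0. \<forall>\<^sub>F k in sequentially.
       \<exists>A\<in>sets M. measure M A < \<eta> \<and>
         {\<omega>\<in>space M.
            (INF f\<in>fluid_limits Q eps l C L lam x0.
               SUP t\<in>{0..s}. ereal (Max ((\<lambda>i. \<bar>real (chainX Q eps l N0 C L lam (X0 k)
                    (\<lambda>m. U m \<omega>) (\<lambda>m. E m \<omega>) (real (z k) * t) i) / real (z k) - f t i\<bar>)
                    ` {..<ncells Q eps})))
            > ereal \<delta>} \<subseteq> A)"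
proof -
  interpret network Q eps N0 C L lam l
    by (rule network.intro) fact+
  interpret prob_space M by fact
  have E: "\<And>m. distributed M lborel (E m) (\<lambda>x. ennreal (exponential_density 1 x))"
    using assms(13) by blast
  have U: "\<And>m. distributed M lborel (U m) (\<lambda>x. ennreal (indicator {0..1} x))"
    using assms(14) by blast
  have X0_lim: "\<And>i. i < n \<Longrightarrow> (\<lambda>k. real (X0 k i) / real (z k)) \<longlonglongrightarrow> x0 i"
    using assms(17) by blast
  note indep = assms(12) and z_lim = assms(16)
  let ?S = "fluid_limits Q eps l C L lam x0"
  let ?p = "\<lambda>k \<omega> t i. real (chain_path (X0 k) (\<lambda>m. U m \<omega>) (\<lambda>m. E m \<omega>) (real (z k) * t) i) / real (z k)"
  have close: "\<forall>\<^sub>F k in sequentially. \<exists>A\<in>sets M. measure M A < \<eta> \<and>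
      (\<forall>\<omega>\<in>space M - A. \<exists>f\<in>?S. \<forall>t\<in>{0..s}. \<forall>i<n. \<bar>?p k \<omega> t i - f t i\<bar> \<le> \<delta>)"
    if \<delta>: "\<delta> > 0" and \<eta>: "\<eta> > 0" for s \<delta> \<eta> :: real
  proof -
    obtain \<theta> T k0 where \<theta>: "\<theta> > 0" and near: "\<And>k Y. k \<ge> k0 \<Longrightarrow> near_fluid \<theta> T (z k) (X0 k) Y \<Longrightarrow>
        \<exists>f\<in>?S. \<forall>t\<in>{0..s}. \<forall>i<n. \<bar>real (Y t i) / real (z k) - f t i\<bar> \<le> \<delta>"
      by (rule near_fluid_close[OF z_lim X0_lim \<delta>, where s = s]) (assumption, rule that)
    from chain_near_fluid_with_high_probability[OF \<open>prob_space M\<close> indep E U \<theta> \<eta>, where T = T]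
    obtain z0 where z0: "\<forall>z X. real z \<ge> z0 \<longrightarrow> (\<exists>A\<in>sets M. measure M A < \<eta> \<and> (\<forall>\<omega>\<in>space M - A.
        near_fluid \<theta> T z X (\<lambda>t. chain_path X (\<lambda>m. U m \<omega>) (\<lambda>m. E m \<omega>) (real z * t))))" ..
    have "\<forall>\<^sub>F k in sequentially. real (z k) \<ge> z0"
      using z_lim by (simp add: filterlim_at_top)
    with eventually_ge_at_top[of k0] show ?thesis
    proof eventually_elim
      case (elim k)
      from z0[THEN spec, THEN spec, THEN mp, OF elim(2), of "X0 k"] obtain A where A: "A \<in> sets M" "measure M A < \<eta>"
        "\<And>\<omega>. \<omega> \<in> space M - A \<Longrightarrow> near_fluid \<theta> T (z k) (X0 k)
          (\<lambda>t. chain_path (X0 k) (\<lambda>m. U m \<omega>) (\<lambda>m. E m \<omega>) (real (z k) * t))"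
        by blast
      show ?case
        using A(1,2) near[OF elim(1) A(3)] by blast
    qed
  qed
  show ?thesis
  proof (intro conjI allI impI)
    \<comment> \<open>With \<open>\<eta> = 1\<close> the exceptional set cannot exhaust the space,
      and any outcome left over comes with an element of \<open>?S\<close>. Tolerance 1 and horizon
      0 are arbitrary.\<close>
    from eventually_happens[OF close[of 1 1 0]] obtain k A where A: "A \<in> sets M" "measure M A < 1"
      "\<forall>\<omega>\<in>space M - A. \<exists>f\<in>?S. \<forall>t\<in>{0..0}. \<forall>i<n. \<bar>?p k \<omega> t i - f t i\<bar> \<le> 1"
      by auto
    have "space M - A \<noteq> {}"
    proof
      assume "space M - A = {}"
      then have "A = space M" using sets.sets_into_space[OF A(1)] by blast
      then show False using A(2) prob_space by simp
    qed
    then show "?S \<noteq> {}" using A(3) by blast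
  next
    fix s \<delta> \<eta> :: real assume "0 < s" "0 < \<delta>" "0 < \<eta>"
    show "\<forall>\<^sub>F k in sequentially. \<exists>A\<in>sets M. measure M A < \<eta> \<and>
         {\<omega>\<in>space M. (INF f\<in>?S. SUP t\<in>{0..s}. ereal (Max ((\<lambda>i. \<bar>?p k \<omega> t i - f t i\<bar>) ` {..<n}))) > ereal \<delta>} \<subseteq> A"
      using close[OF \<open>0 < \<delta>\<close> \<open>0 < \<eta>\<close>, of s]
    proof eventually_elim
      case (elim k)
      then obtain A where A: "A \<in> sets M" "measure M A < \<eta>"
        "\<And>\<omega>. \<omega> \<in> space M - A \<Longrightarrow> \<exists>f\<in>?S. \<forall>t\<in>{0..s}. \<forall>i<n. \<bar>?p k \<omega> t i - f t i\<bar> \<le> \<delta>"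
        by blast
      have "(INF f\<in>?S. SUP t\<in>{0..s}. ereal (Max ((\<lambda>i. \<bar>?p k \<omega> t i - f t i\<bar>) ` {..<n}))) \<le> ereal \<delta>"
        if \<omega>: "\<omega> \<in> space M - A" for \<omega>
      proof -
        obtain f where f: "f \<in> ?S" "\<forall>t\<in>{0..s}. \<forall>i<n. \<bar>?p k \<omega> t i - f t i\<bar> \<le> \<delta>"
          using A(3)[OF \<omega>] by blast
        show ?thesis
        proof (rule INF_lower2[OF f(1)], rule SUP_least)
          fix t assume "t \<in> {0..s}"
          then have "Max ((\<lambda>i. \<bar>?p k \<omega> t i - f t i\<bar>) ` {..<n}) \<le> \<delta>"
            using f(2) n_pos by (subst Max_le_iff) auto
          then show "ereal (Max ((\<lambda>i. \<bar>?p k \<omega> t i - f t i\<bar>) ` {..<n})) \<le> ereal \<delta>" by simp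
        qed
      qed
      then show ?case using A(1,2) by (intro bexI[of _ A] conjI) (auto simp: not_less[symmetric])
    qed
  qed
qed

end
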